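(* Let the contour $]0,1[\ni s\mapsto\tau(s)$, denoted $\gamma$, satisfy $$\big(\sqrt2z_0-\tau^{-1}z_{-3}+\tau z_3\big)^\nu\tau^{-\lambda}\Big|_{\tau(0)}^{\tau(1)}=0.$$ Then the function $$K_{\alpha,\nu,\lambda}(z_0,z_{-2},z_2,z_{-3},z_3):=\int_\gamma z_2^\alpha\big(\sqrt2z_0-\tau^{-1}z_{-3}+\tau z_3\big)^\nu\tau^{-\lambda-1}\,d\tau$$ is harmonic, i.e. $(\partial_{z_0}^2+2\partial_{z_{-2}}\partial_{z_2}+2\partial_{z_{-3}}\partial_{z_3})K_{\alpha,\nu,\lambda}=0$, and $$N_2K_{\alpha,\nu,\lambda}=\alpha K_{\alpha,\nu,\lambda},\qquad N_3K_{\alpha,\nu,\lambda}=\lambda K_{\alpha,\nu,\lambda}.$$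
   Context: $\alpha,\nu,\lambda$ are complex parameters. $\mathbb R^5$ has coordinates $z_0,z_{-2},z_2,z_{-3},z_3$ and scalar product $\langle z|z\rangle=z_0^2+2z_{-2}z_2+2z_{-3}z_3$ (formulas are understood to be continued analytically to appropriate complex domains). $N_j:=-z_{-j}\partial_{z_{-j}}+z_j\partial_{z_j}$ for $j=2,3$. $G(\tau)\big|_{\tau(0)}^{\tau(1)}$ denotes the difference of the values of $G$ at the two ends of the contour. *)

theory Defs
  imports "HOL-Complex_Analysis.Complex_Analysis"
begin

(* Indices of the coordinates z_0, z_{-2}, z_2, z_{-3}, z_3. *)
datatype coord = C0 | Cm2 | C2 | Cm3 | C3

instance coord :: finite
proof
  have "UNIV = {C0, Cm2, C2, Cm3, C3}"
    using coord.exhaust by blast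
  then show "finite (UNIV :: coord set)"
    by (metis finite.emptyI finite_insert)
qed

definition set_coord :: "complex ^ coord \<Rightarrow> coord \<Rightarrow> complex \<Rightarrow> complex ^ coord" where
  "set_coord z j w = (\<chi> i. if i = j then w else z $ i)"

definition partial :: "coord \<Rightarrow> (complex ^ coord \<Rightarrow> complex) \<Rightarrow> complex ^ coord \<Rightarrow> complex" where
  "partial j f z = deriv (\<lambda>w. f (set_coord z j w)) (z $ j)"

(* Holomorphy in several variables: continuous and holomorphic in each variable separately.
   On an open set this guarantees that the iterated partial derivatives below
   are genuine derivatives and not default values of deriv. *)
definition sev_holomorphic_on :: "(complex ^ coord \<Rightarrow> complex) \<Rightarrow> (complex ^ coord) set \<Rightarrow> bool" where
  "sev_holomorphic_on f D \<longleftrightarrow> continuous_on D f \<and>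
     (\<forall>z\<in>D. \<forall>j. (\<lambda>w. f (set_coord z j w)) field_differentiable (at (z $ j)))"

(* The Laplacian of the scalar product z_0^2 + 2 z_{-2} z_2 + 2 z_{-3} z_3. *)
definition laplacian :: "(complex ^ coord \<Rightarrow> complex) \<Rightarrow> complex ^ coord \<Rightarrow> complex" where
  "laplacian f z =
     partial C0 (partial C0 f) z + 2 * partial Cm2 (partial C2 f) z + 2 * partial Cm3 (partial C3 f) z"

definition harmonic_on :: "(complex ^ coord \<Rightarrow> complex) \<Rightarrow> (complex ^ coord) set \<Rightarrow> bool" where
  "harmonic_on f D \<longleftrightarrow> sev_holomorphic_on f D \<and> (\<forall>z\<in>D. laplacian f z = 0)"

definition N2 :: "(complex ^ coord \<Rightarrow> complex) \<Rightarrow> complex ^ coord \<Rightarrow> complex" where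
  "N2 f z = - z $ Cm2 * partial Cm2 f z + z $ C2 * partial C2 f z"

definition N3 :: "(complex ^ coord \<Rightarrow> complex) \<Rightarrow> complex ^ coord \<Rightarrow> complex" where
  "N3 f z = - z $ Cm3 * partial Cm3 f z + z $ C3 * partial C3 f z"

(* p is a branch on X of the (in general multivalued) power w^a: obtained from a continuous
   branch L of log w, or, for an integer exponent, the ordinary power, for which zeros
   of w are harmless if a is nonnegative. *)
definition power_branch ::
    "'a::topological_space set \<Rightarrow> ('a \<Rightarrow> complex) \<Rightarrow> complex \<Rightarrow> ('a \<Rightarrow> complex) \<Rightarrow> bool" where
  "power_branch X w a p \<longleftrightarrow>
     (\<exists>L. continuous_on X L \<and> (\<forall>x\<in>X. exp (L x) = w x \<and> p x = exp (a * L x))) \<or>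
     (\<exists>n::int. a = of_int n \<and> (\<forall>x\<in>X. (n < 0 \<longrightarrow> w x \<noteq> 0) \<and> p x = w x powi n))"

definition kernel_base :: "complex \<Rightarrow> complex ^ coord \<Rightarrow> complex" where
  "kernel_base t z = complex_of_real (sqrt 2) * z $ C0 - inverse t * z $ Cm3 + t * z $ C3"

(* The integrand of K pulled back to the parameter s. Here pz is the branch of z_2^alpha,
   pu (s, z) that of kernel_base (tau s) z to the power nu, and l the branch of log tau.
   The branches are functions of s rather than of tau s: a contour may cross itself
   on different sheets. *)
definition K_integrand ::
    "complex \<Rightarrow> (real \<Rightarrow> complex) \<Rightarrow> (real \<Rightarrow> complex) \<Rightarrow> (complex ^ coord \<Rightarrow> complex) \<Rightarrow>
     (real \<times> (complex ^ coord) \<Rightarrow> complex) \<Rightarrow> complex ^ coord \<Rightarrow> real \<Rightarrow> complex" where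
  "K_integrand lam tau l pz pu z s =
     pz z * pu (s, z) * exp ((- lam - 1) * l s) * vector_derivative tau (at s)"

(* The gauge integral over the open interval includes improper, possibly only conditionally
   convergent, integrals along contours running into a singularity or to infinity. *)
definition K ::
    "complex \<Rightarrow> (real \<Rightarrow> complex) \<Rightarrow> (real \<Rightarrow> complex) \<Rightarrow> (complex ^ coord \<Rightarrow> complex) \<Rightarrow>
     (real \<times> (complex ^ coord) \<Rightarrow> complex) \<Rightarrow> complex ^ coord \<Rightarrow> complex" where
  "K lam tau l pz pu z = integral {0<..<1} (K_integrand lam tau l pz pu z)"

definition K_locally_uniformly_convergent ::
    "(complex ^ coord) set \<Rightarrow> complex \<Rightarrow> (real \<Rightarrow> complex) \<Rightarrow> (real \<Rightarrow> complex) \<Rightarrow>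
     (complex ^ coord \<Rightarrow> complex) \<Rightarrow> (real \<times> (complex ^ coord) \<Rightarrow> complex) \<Rightarrow> bool" where
  "K_locally_uniformly_convergent D lam tau l pz pu \<longleftrightarrow>
     (\<forall>z\<in>D. K_integrand lam tau l pz pu z integrable_on {0<..<1}) \<and>
     (\<forall>z\<in>D. \<exists>U. open U \<and> z \<in> U \<and> U \<subseteq> D \<and>
        uniform_limit U (\<lambda>(a, b) y. integral {a..b} (K_integrand lam tau l pz pu y))
          (K lam tau l pz pu) (at_right 0 \<times>\<^sub>F at_left 1))"

(* Values at the ends of a contour parametrized by the open interval are limits. *)
definition end_difference_zero :: "(real \<Rightarrow> complex) \<Rightarrow> bool" where
  "end_difference_zero G \<longleftrightarrow>
     (\<exists>g0 g1. (G \<longlongrightarrow> g0) (at_right 0) \<and> (G \<longlongrightarrow> g1) (at_left 1) \<and> g1 - g0 = 0)"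

end

theory Submission
  imports Defs
begin

text \<open>Over a compact part of the contour, the integrand is harmonic because it is a function of
  \<open>z\<^sub>2\<close> times a function of an isotropic linear form; it is homogeneous of degree \<open>\<alpha>\<close> in \<open>z\<^sub>2\<close>, and
  \<open>N\<^sub>3 - \<lambda>\<close> turns it into the exact differential of
  \<open>z\<^sub>2\<^sup>\<alpha> (\<surd>2 z\<^sub>0 - \<tau>\<inverse> z\<^sub>-\<^sub>3 + \<tau> z\<^sub>3)\<^sup>\<nu> \<tau>\<^sup>-\<^sup>\<lambda>\<close>, so that only the difference of its values at the two ends survives.
  By the Cauchy estimates, locally uniform convergence carries all partial derivatives to the
  limit, where this difference vanishes.\<close>

text \<open>The powers are multivalued and the contour may cross itself on different sheets, so the
  integrand need not be a function of \<tau> at all. Near one parameter value and one point z,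
  however, each of the three branches is a holomorphic function of its own base. The equations are
  proved there for short pieces of the contour, and the pieces are then glued; the boundary terms at
  a common end cancel. The factor sqrt 2 makes the linear form isotropic: its coefficients give
  (sqrt 2)^2 + 2 * (- 1/\<tau>) * \<tau> = 0. The differential is exact because N3, applied to this
  linear form, acts as \<tau> d/d\<tau>: both give z_{-3}/\<tau> + \<tau> z_3. Integration by parts
  moves this derivative to the power of \<tau>, and the factor \<lambda> appears. The Laplacian has
  second order, so one passage to the limit under a derivative does not suffice: a first partial
  derivative must itself be holomorphic, and must converge uniformly nearby, before the second one
  is taken.\<close>

unbundle no fps_syntax

section \<open>Changing one coordinate, and locality of partial derivatives\<close>

lemma set_coord_nth [simp]: "set_coord z j w $ i = (if i = j then w else z $ i)"
  by (simp add: set_coord_def)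

lemma set_coord_same [simp]: "set_coord z j (z $ j) = z"
  by (simp add: vec_eq_iff)

lemma set_coord_set_coord [simp]: "set_coord (set_coord z j v) j w = set_coord z j w"
  by (simp add: vec_eq_iff)

lemma set_coord_commute: "i \<noteq> j \<Longrightarrow> set_coord (set_coord z i v) j w = set_coord (set_coord z j w) i v"
  by (simp add: vec_eq_iff)

lemma dist_set_coord: "dist z (set_coord z j w) = dist (z $ j) w"
proof -
  have "(\<Sum>i\<in>UNIV. (dist (z $ i) (set_coord z j w $ i))\<^sup>2)
          = (\<Sum>i\<in>UNIV. if i = j then (dist (z $ j) w)\<^sup>2 else 0)"
    by (intro sum.cong) auto
  then show ?thesis
    by (simp add: dist_vec_def L2_set_def)
qed

lemma continuous_on_set_coord [continuous_intros]:
  "continuous_on S f \<Longrightarrow> continuous_on S g \<Longrightarrow> continuous_on S (\<lambda>x. set_coord (f x) j (g x))"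
  unfolding set_coord_def
proof (rule continuous_on_vec_lambda)
  fix i
  assume "continuous_on S f" "continuous_on S g"
  then show "continuous_on S (\<lambda>x. if i = j then g x else f x $ i)"
    by (cases "i = j") (auto intro: continuous_on_component)
qed

lemma eventually_set_coord:
  assumes "open U" "z \<in> U"
  shows "\<forall>\<^sub>F w in nhds (z $ j). set_coord z j w \<in> U"
proof -
  have "isCont (\<lambda>w. set_coord z j w) (z $ j)"
    using continuous_on_set_coord[of UNIV "\<lambda>_. z" "\<lambda>w. w" j]
    by (simp add: continuous_on_eq_continuous_at)
  then have "((\<lambda>w. set_coord z j w) \<longlongrightarrow> z) (nhds (z $ j))"
    using tendsto_at_iff_tendsto_nhds[of "\<lambda>w. set_coord z j w" "z $ j"]
    by (simp add: isCont_def)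
  then show ?thesis
    using assms by (auto simp: tendsto_def)
qed

lemma partial_cong:
  assumes "open U" "z \<in> U" "\<And>y. y \<in> U \<Longrightarrow> f y = g y"
  shows "partial j f z = partial j g z"
  unfolding partial_def
  using eventually_set_coord[OF assms(1,2), of j]
  by (intro deriv_cong_ev) (auto elim!: eventually_mono simp: assms(3))

section \<open>Separately holomorphic functions: closure properties, Cauchy estimates, uniform
  limits\<close>

lemma sev_holomorphic_on_subset: "sev_holomorphic_on f U \<Longrightarrow> V \<subseteq> U \<Longrightarrow> sev_holomorphic_on f V"
  unfolding sev_holomorphic_on_def by (meson continuous_on_subset subset_iff)

lemma sev_holomorphic_onI_local:
  assumes "\<And>z. z \<in> U \<Longrightarrow> \<exists>V. open V \<and> z \<in> V \<and> sev_holomorphic_on f V"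
  shows "sev_holomorphic_on f U"
  unfolding sev_holomorphic_on_def
proof (intro conjI ballI allI)
  show "continuous_on U f"
  proof (rule continuous_at_imp_continuous_on, rule ballI)
    fix z assume "z \<in> U"
    with assms obtain V where "open V" "z \<in> V" "sev_holomorphic_on f V" by blast
    then show "isCont f z"
      by (auto simp: sev_holomorphic_on_def continuous_on_eq_continuous_at)
  qed
  show "(\<lambda>w. f (set_coord z j w)) field_differentiable at (z $ j)" if "z \<in> U" for z j
    using assms[OF that] unfolding sev_holomorphic_on_def by blast
qed

lemma sev_holomorphic_on_cong:
  assumes "sev_holomorphic_on f U" "open U" "\<And>y. y \<in> U \<Longrightarrow> f y = g y"
  shows "sev_holomorphic_on g U"
  unfolding sev_holomorphic_on_def
proof (intro conjI ballI allI)
  show "continuous_on U g"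
    using assms(1,3) continuous_on_cong[of U U f g] by (simp add: sev_holomorphic_on_def)
  fix z j assume z: "z \<in> U"
  have "\<forall>\<^sub>F w in nhds (z $ j). f (set_coord z j w) = g (set_coord z j w)"
    using eventually_set_coord[OF assms(2) z, of j] by eventually_elim (rule assms(3))
  moreover have "(\<lambda>w. f (set_coord z j w)) field_differentiable at (z $ j)"
    using assms(1) z by (simp add: sev_holomorphic_on_def)
  ultimately show "(\<lambda>w. g (set_coord z j w)) field_differentiable at (z $ j)"
    unfolding field_differentiable_def by (simp add: DERIV_cong_ev[OF refl _ refl])
qed

lemma sev_holomorphic_on_slice:
  assumes "sev_holomorphic_on f U" "\<And>w. w \<in> A \<Longrightarrow> set_coord z j w \<in> U"
  shows "(\<lambda>w. f (set_coord z j w)) holomorphic_on A"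
  unfolding holomorphic_on_def
proof
  fix w assume "w \<in> A"
  then have "set_coord z j w \<in> U" by (rule assms(2))
  then have "(\<lambda>v. f (set_coord (set_coord z j w) j v)) field_differentiable at (set_coord z j w $ j)"
    using assms(1) unfolding sev_holomorphic_on_def by blast
  then show "(\<lambda>v. f (set_coord z j v)) field_differentiable at w within A"
    by (simp add: field_differentiable_at_within)
qed

lemma has_partial:
  assumes "sev_holomorphic_on f U" "z \<in> U"
  shows "((\<lambda>w. f (set_coord z j w)) has_field_derivative partial j f z) (at (z $ j))"
  using assms unfolding sev_holomorphic_on_def partial_def
  by (simp add: DERIV_deriv_iff_field_differentiable)

lemma partial_eqI:
  "((\<lambda>w. f (set_coord z j w)) has_field_derivative d) (at (z $ j)) \<Longrightarrow> partial j f z = d"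
  unfolding partial_def by (rule DERIV_imp_deriv)

lemma sev_holomorphic_on_add:
  "sev_holomorphic_on f U \<Longrightarrow> sev_holomorphic_on g U \<Longrightarrow> sev_holomorphic_on (\<lambda>z. f z + g z) U"
  unfolding sev_holomorphic_on_def
  by (auto intro!: continuous_on_add field_differentiable_add)

lemma sev_holomorphic_on_diff:
  "sev_holomorphic_on f U \<Longrightarrow> sev_holomorphic_on g U \<Longrightarrow> sev_holomorphic_on (\<lambda>z. f z - g z) U"
  unfolding sev_holomorphic_on_def
  by (auto intro!: continuous_on_diff field_differentiable_diff)

lemma partial_add:
  assumes "sev_holomorphic_on f U" "sev_holomorphic_on g U" "z \<in> U"
  shows "partial j (\<lambda>z. f z + g z) z = partial j f z + partial j g z"
  by (rule partial_eqI) (intro DERIV_add has_partial[OF assms(1,3)] has_partial[OF assms(2,3)])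

lemma partial_diff:
  assumes "sev_holomorphic_on f U" "sev_holomorphic_on g U" "z \<in> U"
  shows "partial j (\<lambda>z. f z - g z) z = partial j f z - partial j g z"
  by (rule partial_eqI) (intro DERIV_diff has_partial[OF assms(1,3)] has_partial[OF assms(2,3)])

text \<open>Cauchy's inequality for the slice in direction \<open>j\<close>. Since
  \<open>set_coord z j\<close> is an isometry, the disc of radius \<open>r\<close> in the slice
  stays in the ball of radius \<open>r\<close>.\<close>

lemma norm_partial_le:
  assumes f: "sev_holomorphic_on f U" and "cball z r \<subseteq> U" "0 < r"
    and B: "\<And>y. y \<in> cball z r \<Longrightarrow> norm (f y) \<le> B"
  shows "norm (partial j f z) \<le> B / r"
proof -
  let ?g = "\<lambda>w. f (set_coord z j w)"
  have in_ball: "set_coord z j w \<in> cball z r" if "w \<in> cball (z $ j) r" for w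
    using that by (simp add: dist_set_coord)
  have hol: "?g holomorphic_on cball (z $ j) r"
    using in_ball assms(2) by (intro sev_holomorphic_on_slice[OF f]) blast
  have "norm ((deriv ^^ 1) ?g (z $ j)) \<le> fact 1 * B / r ^ 1"
  proof (rule Cauchy_inequality)
    show "?g holomorphic_on ball (z $ j) r"
      using hol by (rule holomorphic_on_subset) auto
    show "continuous_on (cball (z $ j) r) ?g"
      using hol by (rule holomorphic_on_imp_continuous_on)
    fix w assume "norm (z $ j - w) = r"
    then show "norm (?g w) \<le> B"
      by (intro B in_ball) (simp add: dist_norm)
  qed fact
  then show ?thesis
    by (simp add: partial_def)
qed

text \<open>Weierstrass' theorem is applied on each slice; joint continuity passes to the limit
  because the convergence is uniform on all of \<open>U\<close>.\<close>

lemma sev_holomorphic_on_uniform_limit: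
  assumes "open U" and f: "\<forall>\<^sub>F n in F. sev_holomorphic_on (f n) U"
    and lim: "uniform_limit U f g F" and F: "F \<noteq> bot"
  shows "sev_holomorphic_on g U"
  unfolding sev_holomorphic_on_def
proof (intro conjI ballI allI)
  show "continuous_on U g"
    using f by (intro uniform_limit_theorem[OF _ lim F]) (auto elim: eventually_mono simp: sev_holomorphic_on_def)
  fix z j assume "z \<in> U"
  then obtain r where r: "0 < r" "cball z r \<subseteq> U"
    using \<open>open U\<close> open_contains_cball by blast
  have in_U: "set_coord z j w \<in> U" if "w \<in> cball (z $ j) r" for w
    using that r(2) by (auto simp: subset_iff dist_set_coord)
  have "(\<lambda>w. g (set_coord z j w)) holomorphic_on ball (z $ j) r"
  proof (rule holomorphic_uniform_limit)
    show "\<forall>\<^sub>F n in F. continuous_on (cball (z $ j) r) (\<lambda>w. f n (set_coord z j w)) \<and>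
            (\<lambda>w. f n (set_coord z j w)) holomorphic_on ball (z $ j) r"
      using f
    proof eventually_elim
      case (elim n)
      then have "(\<lambda>w. f n (set_coord z j w)) holomorphic_on cball (z $ j) r"
        using in_U by (rule sev_holomorphic_on_slice)
      then show ?case
        by (auto intro: holomorphic_on_imp_continuous_on holomorphic_on_subset)
    qed
    show "uniform_limit (cball (z $ j) r) (\<lambda>n w. f n (set_coord z j w)) (\<lambda>w. g (set_coord z j w)) F"
      using lim in_U by (auto simp: uniform_limit_iff elim!: eventually_mono)
  qed (use F in auto)
  then show "(\<lambda>w. g (set_coord z j w)) field_differentiable at (z $ j)"
    by (rule holomorphic_on_imp_differentiable_at) (use r in auto)
qed

text \<open>The Cauchy estimate is applied to the difference \<open>f n - g\<close>. The passage to
  a smaller \<open>V\<close> provides one radius that serves all centres in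
  \<open>V\<close>.\<close>

lemma partial_uniform_limit:
  assumes "open U" and f: "\<forall>\<^sub>F n in F. sev_holomorphic_on (f n) U"
    and lim: "uniform_limit U f g F" and F: "F \<noteq> bot" and "z \<in> U"
  shows "\<exists>V. open V \<and> z \<in> V \<and> V \<subseteq> U \<and>
           uniform_limit V (\<lambda>n. partial j (f n)) (partial j g) F"
proof -
  obtain r where r: "0 < r" "cball z (2 * r) \<subseteq> U"
  proof -
    obtain e where "0 < e" "cball z e \<subseteq> U"
      using assms(1,5) open_contains_cball by blast
    then show ?thesis
      by (intro that[of "e / 2"]) auto
  qed
  have sub: "cball y r \<subseteq> U" if "y \<in> ball z r" for y
  proof
    fix x assume "x \<in> cball y r"
    with that have "x \<in> cball z (2 * r)"
      using dist_triangle[of z x y] by simp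
    then show "x \<in> U" using r by blast
  qed
  have g: "sev_holomorphic_on g U"
    using assms(1) f lim F by (rule sev_holomorphic_on_uniform_limit)
  have "uniform_limit (ball z r) (\<lambda>n. partial j (f n)) (partial j g) F"
    unfolding uniform_limit_iff
  proof (intro allI impI)
    fix e :: real assume "0 < e"
    \<comment> \<open>Division by \<open>r\<close> in the Cauchy estimate turns this tolerance into
      \<open>e / 2\<close>, which is strictly below \<open>e\<close>.\<close>
    then have "\<forall>\<^sub>F n in F. \<forall>y\<in>U. dist (f n y) (g y) < e * r / 2"
      using r(1) by (intro uniform_limitD[OF lim]) simp
    with f show "\<forall>\<^sub>F n in F. \<forall>y\<in>ball z r. dist (partial j (f n) y) (partial j g y) < e"
    proof eventually_elim
      case (elim n)
      show ?case
      proof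
        fix y assume y: "y \<in> ball z r"
        have "y \<in> U" using sub[OF y] r(1) by auto
        have "norm (partial j (\<lambda>x. f n x - g x) y) \<le> (e * r / 2) / r"
        proof (rule norm_partial_le[OF sev_holomorphic_on_diff[OF elim(1) g] sub[OF y] r(1)])
          fix x assume "x \<in> cball y r"
          then have "x \<in> U" using sub[OF y] by blast
          then show "norm (f n x - g x) \<le> e * r / 2"
            using elim(2) by (auto simp: dist_norm intro: less_imp_le)
        qed
        then show "dist (partial j (f n) y) (partial j g y) < e"
          using r(1) \<open>0 < e\<close> by (simp add: partial_diff[OF elim(1) g \<open>y \<in> U\<close>] dist_norm)
      qed
    qed
  qed
  moreover have "ball z r \<subseteq> U"
    using sub r(1) by (meson centre_in_cball less_imp_le subset_iff)
  ultimately show ?thesis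
    using r(1) by (intro exI[of _ "ball z r"]) auto
qed

text \<open>This is Taylor's formula of first order. Cauchy's inequality on circles of radius
  \<open>r / 2\<close> bounds the second derivative by 2! * B / (r/2)^2, whence the constant 8. The
  bound depends only on \<open>B\<close> and \<open>r\<close>, hence is uniform in the centre
  \<open>a\<close>.\<close>

lemma difference_quotient_bound:
  assumes g: "g holomorphic_on ball a (2 * r)" and B: "\<And>w. w \<in> ball a (2 * r) \<Longrightarrow> norm (g w) \<le> B"
    and "norm h < r" "h \<noteq> 0"
  shows "norm ((g (a + h) - g a) / h - deriv g a) \<le> 8 * B / r\<^sup>2 * norm h"
proof -
  have r: "0 < r"
    using assms(3) norm_ge_zero[of h] by linarith
  have hol: "(deriv ^^ i) g holomorphic_on ball a (2 * r)" for i
    by (rule holomorphic_higher_deriv[OF g]) auto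
  have "norm ((deriv ^^ 0) g (a + h) - (\<Sum>i\<le>1. (deriv ^^ i) g a * (a + h - a) ^ i / fact i))
          \<le> (8 * B / r\<^sup>2) * norm (a + h - a) ^ Suc 1 / fact 1"
  proof (rule field_Taylor[of "ball a r" 1 "\<lambda>i. (deriv ^^ i) g"])
    fix i :: nat and x assume "x \<in> ball a r"
    then have x: "x \<in> ball a (2 * r)" using r by auto
    show "((deriv ^^ i) g has_field_derivative (deriv ^^ Suc i) g x) (at x within ball a r)"
      using holomorphic_derivI[OF hol[of i] open_ball x] by simp
  next
    fix x assume x: "x \<in> ball a r"
    have sub: "w \<in> ball a (2 * r)" if "w \<in> cball x (r / 2)" for w
    proof -
      have "dist a w \<le> dist a x + dist x w" by (rule dist_triangle)
      with that x r show ?thesis by auto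
    qed
    have "norm ((deriv ^^ 2) g x) \<le> fact 2 * B / (r / 2) ^ 2"
    proof (rule Cauchy_inequality)
      show "g holomorphic_on ball x (r / 2)"
        using sub by (intro holomorphic_on_subset[OF g]) auto
      show "continuous_on (cball x (r / 2)) g"
        using sub by (intro continuous_on_subset[OF holomorphic_on_imp_continuous_on[OF g]]) auto
      show "norm (g w) \<le> B" if "norm (x - w) = r / 2" for w
        using that by (intro B sub) (simp add: dist_norm)
    qed (use r in auto)
    then show "norm ((deriv ^^ Suc 1) g x) \<le> 8 * B / r\<^sup>2"
      by (simp add: numeral_2_eq_2 power2_eq_square)
  qed (use assms(3) r in \<open>auto simp: dist_norm\<close>)
  then have "norm (g (a + h) - g a - deriv g a * h) \<le> 8 * B / r\<^sup>2 * norm h * norm h"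
    by (simp add: mult.assoc algebra_simps power2_eq_square)
  then have "norm (g (a + h) - g a - deriv g a * h) / norm h \<le> 8 * B / r\<^sup>2 * norm h"
    using assms(4) by (subst pos_divide_le_eq) auto
  moreover have "(g (a + h) - g a) / h - deriv g a = (g (a + h) - g a - deriv g a * h) / h"
    using assms(4) by (simp add: field_simps)
  ultimately show ?thesis
    by (simp add: norm_divide)
qed

text \<open>The partial derivative is locally a uniform limit of difference quotients, each of which
  is plainly holomorphic in all variables. This makes iterated partial derivatives genuine, as sums
  and limits of Laplacians require.\<close>

lemma sev_holomorphic_on_partial:
  assumes f: "sev_holomorphic_on f U" and "open U"
  shows "sev_holomorphic_on (partial j f) U"
proof (rule sev_holomorphic_onI_local)
  fix z0 assume "z0 \<in> U"
  \<comment> \<open>A centre may be \<open>r\<close> away from \<open>z0\<close>, and the difference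
    quotient bound uses a disc of radius \<open>2 * r\<close> around it.\<close>
  obtain r where r: "0 < r" "cball z0 (3 * r) \<subseteq> U"
  proof -
    obtain e where "0 < e" "cball z0 e \<subseteq> U"
      using \<open>z0 \<in> U\<close> \<open>open U\<close> open_contains_cball by blast
    then show ?thesis
      by (intro that[of "e / 3"]) auto
  qed
  define q where "q h z = (f (set_coord z j (z $ j + h)) - f z) / h" for h z
  have in_ball: "set_coord z j (z $ j + h) \<in> cball z0 (3 * r)" if "z \<in> ball z0 r" "norm h \<le> 2 * r" for z h
  proof -
    have "dist z0 (set_coord z j (z $ j + h)) \<le> dist z0 z + dist z (set_coord z j (z $ j + h))"
      by (rule dist_triangle)
    also have "dist z (set_coord z j (z $ j + h)) = norm h"
      by (simp add: dist_set_coord) (simp add: dist_norm)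
    finally show ?thesis using that by simp
  qed
  have sub: "ball z0 r \<subseteq> U"
    using r by (auto simp: subset_iff)
  have cont: "continuous_on (cball z0 (3 * r)) f"
    using f r(2) unfolding sev_holomorphic_on_def by (meson continuous_on_subset)
  then have "bounded (f ` cball z0 (3 * r))"
    by (intro compact_imp_bounded compact_continuous_image) auto
  then obtain B where B: "\<And>y. y \<in> cball z0 (3 * r) \<Longrightarrow> norm (f y) \<le> B"
    unfolding bounded_iff by blast
  have "sev_holomorphic_on (partial j f) (ball z0 r)"
  proof (rule sev_holomorphic_on_uniform_limit[where f = q and F = "at 0"])
    have "\<forall>\<^sub>F h in at (0 :: complex). dist h 0 < r \<and> h \<noteq> 0"
      using r(1) unfolding eventually_at by auto
    then show "\<forall>\<^sub>F h in at 0. sev_holomorphic_on (q h) (ball z0 r)"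
    proof eventually_elim
      case (elim h)
      have in_U: "set_coord z j (z $ j + h) \<in> U" if "z \<in> ball z0 r" for z
        using in_ball[OF that, of h] elim r by auto
      show ?case
        unfolding sev_holomorphic_on_def
      proof (intro conjI ballI allI)
        have "continuous_on (ball z0 r) (\<lambda>z. f (set_coord z j (z $ j + h)))"
        proof (rule continuous_on_compose2[where g = f])
          show "continuous_on U f" using f by (simp add: sev_holomorphic_on_def)
        qed (use in_U in \<open>auto intro!: continuous_intros\<close>)
        moreover have "continuous_on (ball z0 r) f"
          using f sub unfolding sev_holomorphic_on_def by (meson continuous_on_subset)
        ultimately show "continuous_on (ball z0 r) (q h)"
          unfolding q_def using elim by (intro continuous_intros) auto
        fix z i assume z: "z \<in> ball z0 r"
        have d: "(\<lambda>w. f (set_coord (set_coord z j (z $ j + h)) i w)) field_differentiable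
                   at (set_coord z j (z $ j + h) $ i)"
          using f in_U[OF z] unfolding sev_holomorphic_on_def by blast
        have "(\<lambda>w. f (set_coord (set_coord z i w) j (set_coord z i w $ j + h))) field_differentiable at (z $ i)"
        \<comment> \<open>In direction \<open>j\<close> the shifted slice is a translate of the
          original one; in another direction the shift and the change of coordinate commute.\<close>
        proof (cases "i = j")
          case True
          have "((\<lambda>w. f (set_coord z j w)) \<circ> (\<lambda>w. w + h)) field_differentiable at (z $ j)"
            using d True by (intro field_differentiable_compose) (auto intro!: derivative_intros)
          then show ?thesis
            using True by (simp add: o_def)
        next
          case False
          then show ?thesis
            using d by (simp add: set_coord_commute[OF False])
        qed
        moreover have "(\<lambda>w. f (set_coord z i w)) field_differentiable at (z $ i)"
          using f sub z unfolding sev_holomorphic_on_def by blast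
        ultimately show "(\<lambda>w. q h (set_coord z i w)) field_differentiable at (z $ i)"
          unfolding q_def using elim by (intro derivative_intros) auto
      qed
    qed
    show "uniform_limit (ball z0 r) q (partial j f) (at 0)"
    proof (rule uniform_limitI)
      fix e :: real assume "0 < e"
      have "((\<lambda>h. 8 * B / r\<^sup>2 * norm h) \<longlongrightarrow> 8 * B / r\<^sup>2 * norm (0 :: complex)) (at (0 :: complex))"
        by (intro tendsto_mult tendsto_const tendsto_norm tendsto_ident_at)
      then have "\<forall>\<^sub>F h in at (0 :: complex). 8 * B / r\<^sup>2 * norm h < e"
        using \<open>0 < e\<close> by (intro order_tendstoD) auto
      moreover have "\<forall>\<^sub>F h in at (0 :: complex). dist h 0 < r \<and> h \<noteq> 0"
        using r(1) unfolding eventually_at by auto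
      ultimately show "\<forall>\<^sub>F h in at 0. \<forall>z\<in>ball z0 r. dist (q h z) (partial j f z) < e"
      proof eventually_elim
        case (elim h)
        show ?case
        proof
          fix z assume z: "z \<in> ball z0 r"
          let ?g = "\<lambda>w. f (set_coord z j w)"
          have inb: "set_coord z j w \<in> cball z0 (3 * r)" if "w \<in> ball (z $ j) (2 * r)" for w
            using in_ball[OF z, of "w - z $ j"] that by (simp add: dist_norm norm_minus_commute)
          have "norm ((?g (z $ j + h) - ?g (z $ j)) / h - deriv ?g (z $ j)) \<le> 8 * B / r\<^sup>2 * norm h"
          proof (rule difference_quotient_bound)
            show "?g holomorphic_on ball (z $ j) (2 * r)"
              using inb r(2) by (intro sev_holomorphic_on_slice[OF f]) blast
            show "norm (?g w) \<le> B" if "w \<in> ball (z $ j) (2 * r)" for w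
              using inb[OF that] by (rule B)
          qed (use elim in auto)
          then show "dist (q h z) (partial j f z) < e"
            using elim by (simp add: q_def partial_def dist_norm)
        qed
      qed
    qed
  qed auto
  then show "\<exists>V. open V \<and> z0 \<in> V \<and> sev_holomorphic_on (partial j f) V"
    using r(1) by (intro exI[of _ "ball z0 r"]) auto
qed

section \<open>Local form of a multivalued power\<close>

text \<open>A branch chosen on \<open>X\<close> is locally one holomorphic germ \<open>F\<close>
  composed with the base \<open>w\<close>. Euler's equation for \<open>F\<close> is stated without
  division, so that it still makes sense at a zero of the base, which an integer exponent may
  allow.\<close>

lemma power_branch_local:
  assumes pb: "power_branch X w a p" and w: "continuous_on X w" and "x0 \<in> X"
  obtains \<epsilon> F U where "0 < \<epsilon>" "open U" "x0 \<in> U" "F holomorphic_on ball (w x0) \<epsilon>"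
    "\<And>u. u \<in> ball (w x0) \<epsilon> \<Longrightarrow> u * deriv F u = a * F u"
    "\<And>x. x \<in> X \<inter> U \<Longrightarrow> w x \<in> ball (w x0) \<epsilon> \<and> p x = F (w x)"
proof -
  have near: "\<exists>U. open U \<and> x0 \<in> U \<and> (\<forall>x \<in> X \<inter> U. g x \<in> ball (g x0) e)"
    if "continuous_on X g" "0 < e" for g :: "'a \<Rightarrow> complex" and e
    using that \<open>x0 \<in> X\<close> unfolding continuous_on_topological
    by (metis Int_iff centre_in_ball open_ball)
  show ?thesis
    using pb unfolding power_branch_def
  proof (elim disjE exE conjE)
    fix L assume L: "continuous_on X L" "\<forall>x\<in>X. exp (L x) = w x \<and> p x = exp (a * L x)"
    define w0 where "w0 = w x0"
    \<comment> \<open>The principal logarithm, recentred at \<open>w0\<close> and shifted by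
      \<open>L x0\<close>, is the branch of the logarithm near \<open>w0\<close> that takes the
      value \<open>L x0\<close> there.\<close>
    define F where "F u = exp (a * (Ln (u / w0) + L x0))" for u
    have "exp (L x0) = w0"
      using L(2) \<open>x0 \<in> X\<close> by (simp add: w0_def)
    then have "w0 \<noteq> 0"
      using exp_not_eq_zero by metis
    \<comment> \<open>Division by \<open>w0\<close> maps this disc to the unit disc around 1, which
      lies in the right half-plane and so avoids the cut of \<open>Ln\<close>.\<close>
    have dom: "u / w0 \<notin> \<real>\<^sub>\<le>\<^sub>0" "u \<noteq> 0" if "u \<in> ball w0 (norm w0)" for u
    proof -
      have "norm (1 - u / w0) < 1"
        using that \<open>w0 \<noteq> 0\<close> by (simp add: dist_norm divide_simps flip: norm_divide) (simp add: norm_divide)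
      then have "0 < Re (u / w0)"
        using abs_Re_le_cmod[of "1 - u / w0"] by simp
      then show "u / w0 \<notin> \<real>\<^sub>\<le>\<^sub>0" "u \<noteq> 0"
        by (auto simp: complex_nonpos_Reals_iff)
    qed
    have F': "(F has_field_derivative a * F u / u) (at u)" if "u \<in> ball w0 (norm w0)" for u
      unfolding F_def using dom[OF that] \<open>w0 \<noteq> 0\<close>
      by (auto intro!: derivative_eq_intros simp: field_simps)
    obtain U1 where U1: "open U1" "x0 \<in> U1" "\<And>x. x \<in> X \<inter> U1 \<Longrightarrow> w x \<in> ball w0 (norm w0)"
      using near[OF w, of "norm w0"] \<open>w0 \<noteq> 0\<close> unfolding w0_def by auto
    \<comment> \<open>The radius \<open>pi\<close> keeps the imaginary part of
      \<open>L x - L x0\<close> inside the strip on which \<open>Ln\<close> inverts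
      \<open>exp\<close>; so the two logarithms coincide and not merely modulo a period.\<close>
    obtain U2 where U2: "open U2" "x0 \<in> U2" "\<And>x. x \<in> X \<inter> U2 \<Longrightarrow> L x \<in> ball (L x0) pi"
      using near[OF L(1), of pi] by auto
    show ?thesis
    proof (rule that[of "norm w0" "U1 \<inter> U2" F, folded w0_def])
      show "F holomorphic_on ball w0 (norm w0)"
        using F' holomorphic_on_open[of "ball w0 (norm w0)" F] by blast
      show "u * deriv F u = a * F u" if "u \<in> ball w0 (norm w0)" for u
        using DERIV_imp_deriv[OF F'[OF that]] dom[OF that] by simp
      fix x assume x: "x \<in> X \<inter> (U1 \<inter> U2)"
      have "norm (L x - L x0) < pi"
        using U2(3)[of x] x by (simp add: dist_norm norm_minus_commute)
      then have "\<bar>Im (L x - L x0)\<bar> < pi"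
        using abs_Im_le_cmod[of "L x - L x0"] by linarith
      then have "Ln (exp (L x - L x0)) = L x - L x0"
        by (intro Ln_exp) auto
      moreover have "exp (L x - L x0) = w x / w0"
        using L(2) x \<open>exp (L x0) = w0\<close> by (simp add: exp_diff)
      ultimately have "p x = F (w x)"
        using L(2) x by (simp add: F_def)
      with U1(3)[of x] x show "w x \<in> ball w0 (norm w0) \<and> p x = F (w x)"
        by auto
    qed (use U1 U2 \<open>w0 \<noteq> 0\<close> in auto)
  next
    fix n :: int assume n: "a = of_int n" "\<forall>x\<in>X. (n < 0 \<longrightarrow> w x \<noteq> 0) \<and> p x = w x powi n"
    \<comment> \<open>For a negative exponent the disc must stay away from 0; otherwise any radius
      serves.\<close>
    define e where "e = (if n < 0 then norm (w x0) else 1)"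
    have "0 < e"
      using n(2) \<open>x0 \<in> X\<close> by (auto simp: e_def)
    have dom: "0 \<le> n \<or> u \<noteq> 0" if "u \<in> ball (w x0) e" for u
      using that by (auto simp: e_def dist_norm split: if_splits)
    obtain U where U: "open U" "x0 \<in> U" "\<forall>x \<in> X \<inter> U. w x \<in> ball (w x0) e"
      using near[OF w \<open>0 < e\<close>] by blast
    show ?thesis
    proof (rule that[of e U "\<lambda>u. u powi n"])
      show "(\<lambda>u. u powi n) holomorphic_on ball (w x0) e"
        using dom by (intro holomorphic_intros) blast
      show "u * deriv (\<lambda>u. u powi n) u = a * u powi n" if "u \<in> ball (w x0) e" for u
      proof -
        have "((\<lambda>u. u powi n) has_field_derivative of_int n * u powi (n - 1)) (at u)"
          using dom[OF that] by (auto intro!: derivative_eq_intros)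
        then have "deriv (\<lambda>u. u powi n) u = of_int n * u powi (n - 1)"
          by (rule DERIV_imp_deriv)
        \<comment> \<open>The rule fails at \<open>n = 0\<close>, \<open>u = 0\<close>, where its
          right side is 1; there the factor \<open>of_int n\<close> makes both sides of Euler's
          equation vanish.\<close>
        moreover have "n = 0 \<or> u powi (n - 1) * u = u powi n"
          using power_int_minus_mult[of u n] by blast
        ultimately show ?thesis
          using n(1) by (auto simp: mult.commute mult.left_commute)
      qed
    qed (use U n(2) \<open>0 < e\<close> in auto)
  qed
qed

section \<open>Integrals of functions of the linear form along a path in the \<tau>-plane\<close>

text \<open>The gradient of the linear form \<open>kernel_base t\<close>, indexed by coordinate so
  that one differentiation lemma covers all directions.\<close>

definition kernel_coeff :: "complex \<Rightarrow> coord \<Rightarrow> complex" where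
  "kernel_coeff t j =
     (case j of C0 \<Rightarrow> of_real (sqrt 2) | Cm3 \<Rightarrow> - inverse t | C3 \<Rightarrow> t | Cm2 \<Rightarrow> 0 | C2 \<Rightarrow> 0)"

lemma kernel_base_set_coord:
  "kernel_base t (set_coord z j w) = kernel_base t z + kernel_coeff t j * (w - z $ j)"
  by (cases j) (simp_all add: kernel_base_def kernel_coeff_def algebra_simps)

lemma continuous_on_kernel_base [continuous_intros]:
  "continuous_on S f \<Longrightarrow> continuous_on S g \<Longrightarrow> (\<And>x. x \<in> S \<Longrightarrow> f x \<noteq> 0) \<Longrightarrow>
     continuous_on S (\<lambda>x. kernel_base (f x) (g x))"
  unfolding kernel_base_def by (intro continuous_intros) auto

lemma continuous_on_kernel_coeff [continuous_intros]:
  "continuous_on S f \<Longrightarrow> (\<And>x. x \<in> S \<Longrightarrow> f x \<noteq> 0) \<Longrightarrow> continuous_on S (\<lambda>x. kernel_coeff (f x) j)"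
  unfolding kernel_coeff_def by (cases j) (auto intro!: continuous_intros)

text \<open>The local model of the integral: \<open>H\<close> stands for the power of z_2,
  \<open>F\<close> for the power of the linear form, and the weight \<open>h\<close> for the power
  of \<tau> together with d\<tau>. General \<open>H\<close>, \<open>F\<close> and \<open>h\<close>
  make this class closed under partial differentiation.\<close>

definition kernel_integral ::
    "(complex \<Rightarrow> complex) \<Rightarrow> (complex \<Rightarrow> complex) \<Rightarrow> (real \<Rightarrow> complex) \<Rightarrow> (real \<Rightarrow> complex) \<Rightarrow>
     complex ^ coord \<Rightarrow> complex" where
  "kernel_integral H F t h z = H (z $ C2) * integral {0..1} (\<lambda>x. F (kernel_base (t x) z) * h x)"

text \<open>\<open>S\<close> and \<open>W\<close> are the domains of \<open>H\<close> and
  \<open>F\<close>; points of \<open>V\<close> keep both arguments inside them for the whole path.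
  The path is only continuous, as its velocity is part of the weight.\<close>

locale kernel_domain =
  fixes S W :: "complex set" and t :: "real \<Rightarrow> complex" and V :: "(complex ^ coord) set"
  assumes open_S: "open S" and open_W: "open W" and open_V: "open V"
    and t: "continuous_on {0..1} t" "\<And>x. x \<in> {0..1} \<Longrightarrow> t x \<noteq> 0"
    and V: "\<And>z. z \<in> V \<Longrightarrow> z $ C2 \<in> S" "\<And>z x. z \<in> V \<Longrightarrow> x \<in> {0..1} \<Longrightarrow> kernel_base (t x) z \<in> W"
begin

lemma integrand_integrable:
  assumes "F holomorphic_on W" "continuous_on {0..1} h" "z \<in> V"
  shows "(\<lambda>x. F (kernel_base (t x) z) * h x) integrable_on {0..1}"
proof (rule integrable_continuous_real, intro continuous_on_mult assms(2))
  show "continuous_on {0..1} (\<lambda>x. F (kernel_base (t x) z))"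
    using V(2)[OF assms(3)] t
    by (intro continuous_on_compose2[OF holomorphic_on_imp_continuous_on[OF assms(1)]])
      (auto intro!: continuous_intros)
qed

lemma kernel_integral_partial:
  assumes H: "H holomorphic_on S" and F: "F holomorphic_on W" and h: "continuous_on {0..1} h"
    and z: "z \<in> V"
  shows "((\<lambda>w. kernel_integral H F t h (set_coord z j w)) has_field_derivative
           (if j = C2 then kernel_integral (deriv H) F t h z
            else kernel_integral H (deriv F) t (\<lambda>x. h x * kernel_coeff (t x) j) z)) (at (z $ j))"
\<comment> \<open>The coordinate z_2 enters only through the outer factor \<open>H\<close>; in every
  other direction the derivative falls on the linear form, under the integral sign.\<close>
proof (cases "j = C2")
  case True
  have "(H has_field_derivative deriv H (z $ C2)) (at (z $ C2))"
    using holomorphic_derivI[OF H open_S V(1)[OF z]] .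
  then show ?thesis
    using True
    by (auto simp: kernel_integral_def kernel_base_set_coord kernel_coeff_def intro: DERIV_cmult_right)
next
  case False
  have "\<forall>\<^sub>F w in nhds (z $ j). set_coord z j w \<in> V"
    using open_V z by (rule eventually_set_coord)
  then obtain r where r: "0 < r" "\<And>w. w \<in> ball (z $ j) r \<Longrightarrow> set_coord z j w \<in> V"
    unfolding eventually_nhds_metric by (auto simp: dist_commute)
  let ?k = "\<lambda>x w. kernel_base (t x) (set_coord z j w)"
  have kW: "?k x w \<in> W" if "w \<in> ball (z $ j) r" "x \<in> {0..1}" for w x
    using V(2) r(2) that by blast
  have "((\<lambda>w. integral (cbox 0 1) (\<lambda>x. F (?k x w) * h x)) has_field_derivative
          integral (cbox 0 1) (\<lambda>x. deriv F (?k x (z $ j)) * kernel_coeff (t x) j * h x))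
          (at (z $ j) within ball (z $ j) r)"
  proof (rule leibniz_rule_field_derivative)
    fix w x assume w: "w \<in> ball (z $ j) r" and x: "x \<in> cbox (0::real) 1"
    have "(F has_field_derivative deriv F (?k x w)) (at (?k x w))"
      using kW[OF w] x by (intro holomorphic_derivI[OF F open_W]) auto
    moreover have "(?k x has_field_derivative kernel_coeff (t x) j) (at w)"
      unfolding kernel_base_set_coord by (auto intro!: derivative_eq_intros)
    ultimately have "((\<lambda>w. F (?k x w)) has_field_derivative deriv F (?k x w) * kernel_coeff (t x) j) (at w)"
      by (rule DERIV_chain2)
    then show "((\<lambda>w. F (?k x w) * h x) has_field_derivative
        deriv F (?k x w) * kernel_coeff (t x) j * h x) (at w within ball (z $ j) r)"
      by (intro DERIV_cmult_right) (rule has_field_derivative_at_within)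
  next
    fix w assume "w \<in> ball (z $ j) r"
    then show "(\<lambda>x. F (?k x w) * h x) integrable_on cbox 0 1"
      using integrand_integrable[OF F h r(2)] by simp
  next
    show "continuous_on (ball (z $ j) r \<times> cbox 0 1)
            (\<lambda>(w, x). deriv F (?k x w) * kernel_coeff (t x) j * h x)"
      unfolding split_beta
    proof (intro continuous_on_mult)
      have t': "continuous_on (ball (z $ j) r \<times> cbox 0 1) (\<lambda>p. t (snd p))"
        by (rule continuous_on_compose2[OF t(1)]) (auto intro!: continuous_intros)
      show "continuous_on (ball (z $ j) r \<times> cbox 0 1) (\<lambda>p. h (snd p))"
        by (rule continuous_on_compose2[OF h]) (auto intro!: continuous_intros)
      show "continuous_on (ball (z $ j) r \<times> cbox 0 1) (\<lambda>p. kernel_coeff (t (snd p)) j)"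
        using t' t(2) by (intro continuous_intros) auto
      show "continuous_on (ball (z $ j) r \<times> cbox 0 1) (\<lambda>p. deriv F (?k (snd p) (fst p)))"
      proof (rule continuous_on_compose2[where g = "deriv F"])
        show "continuous_on W (deriv F)"
          using holomorphic_deriv[OF F open_W] by (rule holomorphic_on_imp_continuous_on)
        show "continuous_on (ball (z $ j) r \<times> cbox 0 1) (\<lambda>p. ?k (snd p) (fst p))"
          using t' t(2) by (intro continuous_intros) auto
      qed (use kW in auto)
    qed
  qed (use r in auto)
  then have "((\<lambda>w. integral {0..1} (\<lambda>x. F (?k x w) * h x)) has_field_derivative
               integral {0..1} (\<lambda>x. deriv F (kernel_base (t x) z) * (h x * kernel_coeff (t x) j))) (at (z $ j))"
    using r(1) by (simp add: at_within_open[of _ "ball (z $ j) r"] mult_ac)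
  then show ?thesis
    using False by (auto simp: kernel_integral_def intro: DERIV_cmult)
qed

lemma sev_holomorphic_on_kernel_integral:
  assumes H: "H holomorphic_on S" and F: "F holomorphic_on W" and h: "continuous_on {0..1} h"
  shows "sev_holomorphic_on (kernel_integral H F t h) V"
  unfolding sev_holomorphic_on_def
proof (intro conjI ballI allI)
  have "continuous_on V (\<lambda>z. integral (cbox 0 1) (\<lambda>x. F (kernel_base (t x) z) * h x))"
  proof (rule integral_continuous_on_param, unfold split_beta, rule continuous_on_mult)
    have t': "continuous_on (V \<times> cbox 0 1) (\<lambda>p. t (snd p))"
      by (rule continuous_on_compose2[OF t(1)]) (auto intro!: continuous_intros)
    show "continuous_on (V \<times> cbox 0 1) (\<lambda>p. h (snd p))"
      by (rule continuous_on_compose2[OF h]) (auto intro!: continuous_intros)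
    show "continuous_on (V \<times> cbox 0 1) (\<lambda>p. F (kernel_base (t (snd p)) (fst p)))"
    proof (rule continuous_on_compose2[OF holomorphic_on_imp_continuous_on[OF F]])
      show "continuous_on (V \<times> cbox 0 1) (\<lambda>p. kernel_base (t (snd p)) (fst p))"
        using t' t(2) by (intro continuous_intros) auto
    qed (use V(2) in auto)
  qed
  moreover have "continuous_on V (\<lambda>z. H (z $ C2))"
    using V(1) by (intro continuous_on_compose2[OF holomorphic_on_imp_continuous_on[OF H]] continuous_intros) auto
  ultimately show "continuous_on V (kernel_integral H F t h)"
    unfolding kernel_integral_def by (simp add: continuous_on_mult)
  fix z j assume "z \<in> V"
  then show "(\<lambda>w. kernel_integral H F t h (set_coord z j w)) field_differentiable at (z $ j)"
    using kernel_integral_partial[OF H F h] unfolding field_differentiable_def by blast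
qed

lemma partial_kernel_integral:
  assumes "H holomorphic_on S" "F holomorphic_on W" "continuous_on {0..1} h" "z \<in> V"
  shows "partial j (kernel_integral H F t h) z =
           (if j = C2 then kernel_integral (deriv H) F t h z
            else kernel_integral H (deriv F) t (\<lambda>x. h x * kernel_coeff (t x) j) z)"
  using kernel_integral_partial[OF assms] by (rule partial_eqI)

text \<open>The vector of the coefficients of the linear form \<^const>\<open>kernel_base\<close> is isotropic,
  so every function of this linear form is harmonic.\<close>

lemma laplacian_kernel_integral:
  assumes H: "H holomorphic_on S" and F: "F holomorphic_on W" and h: "continuous_on {0..1} h" and z: "z \<in> V"
  shows "laplacian (kernel_integral H F t h) z = 0"
proof -
  let ?c = "\<lambda>j x. kernel_coeff (t x) j"
  have hc: "continuous_on {0..1} (\<lambda>x. h x * ?c j x)" for j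
    using t by (intro continuous_intros h) auto
  have H': "deriv H holomorphic_on S" and F': "deriv F holomorphic_on W"
    using H F open_S open_W by (auto intro: holomorphic_deriv)
  have F'': "deriv (deriv F) holomorphic_on W"
    using F' open_W by (rule holomorphic_deriv)
  have second: "partial i (partial j (kernel_integral H F t h)) z =
      kernel_integral H (deriv (deriv F)) t (\<lambda>x. h x * ?c j x * ?c i x) z" if "i \<noteq> C2" "j \<noteq> C2" for i j
  proof -
    have "partial i (partial j (kernel_integral H F t h)) z =
            partial i (kernel_integral H (deriv F) t (\<lambda>x. h x * ?c j x)) z"
      using that by (intro partial_cong[OF open_V z]) (simp add: partial_kernel_integral[OF H F h])
    then show ?thesis
      using that by (simp add: partial_kernel_integral[OF H F' hc z])
  qed
  \<comment> \<open>This term of the Laplacian vanishes by itself, since z_{-2} does not occur in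
    the integral.\<close>
  have "partial Cm2 (partial C2 (kernel_integral H F t h)) z =
          partial Cm2 (kernel_integral (deriv H) F t h) z"
    by (intro partial_cong[OF open_V z]) (simp add: partial_kernel_integral[OF H F h])
  also have "\<dots> = 0"
    by (simp add: partial_kernel_integral[OF H' F h z] kernel_integral_def kernel_coeff_def)
  finally have m2: "partial Cm2 (partial C2 (kernel_integral H F t h)) z = 0" .
  \<comment> \<open>Isotropy in coordinates: the square of sqrt 2 contributes 2, and the product of
    \<open>t\<close> with \<open>- inverse t\<close> contributes -1, counted twice.\<close>
  have "kernel_integral H (deriv (deriv F)) t (\<lambda>x. h x * ?c C0 x * ?c C0 x) z =
          2 * kernel_integral H (deriv (deriv F)) t h z"
  proof -
    have "integral {0..1} (\<lambda>x. deriv (deriv F) (kernel_base (t x) z) * (h x * ?c C0 x * ?c C0 x)) =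
        integral {0..1} (\<lambda>x. 2 * (deriv (deriv F) (kernel_base (t x) z) * h x))"
      by (simp add: kernel_coeff_def mult.assoc mult.left_commute[of _ 2] mult.commute[of _ 2] flip: of_real_mult)
    then show ?thesis
      by (simp add: kernel_integral_def)
  qed
  moreover have "kernel_integral H (deriv (deriv F)) t (\<lambda>x. h x * ?c C3 x * ?c Cm3 x) z =
          - kernel_integral H (deriv (deriv F)) t h z"
  proof -
    have "integral {0..1} (\<lambda>x. deriv (deriv F) (kernel_base (t x) z) * (h x * ?c C3 x * ?c Cm3 x)) =
        integral {0..1} (\<lambda>x. - (deriv (deriv F) (kernel_base (t x) z) * h x))"
      using t(2) by (intro integral_cong) (simp add: kernel_coeff_def)
    then show ?thesis
      by (simp add: kernel_integral_def)
  qed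
  ultimately show ?thesis
    by (simp add: laplacian_def m2 second)
qed

text \<open>Since z_{-2} is absent, N2 reduces to z_2 times the derivative in z_2, and Euler's
  equation for \<open>H\<close> applies.\<close>

lemma N2_kernel_integral:
  assumes H: "H holomorphic_on S" "\<And>u. u \<in> S \<Longrightarrow> u * deriv H u = a * H u"
    and F: "F holomorphic_on W" and h: "continuous_on {0..1} h" and z: "z \<in> V"
  shows "N2 (kernel_integral H F t h) z = a * kernel_integral H F t h z"
  using H(2)[OF V(1)[OF z]]
  by (simp add: N2_def partial_kernel_integral[OF H(1) F h z])
    (simp add: kernel_integral_def kernel_coeff_def flip: mult.assoc)

end

text \<open>With u the variable on the chord, N3 acts on F(base) as u d/du. Hence (N3 - lam) turns F
  * E / u into the derivative of F * E, by Euler's equation for \<open>E\<close>, which plays the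
  role of u^(-lam). Integration leaves the values at the two ends of the chord.\<close>

lemma N3_kernel_integral_linepath:
  assumes dom: "kernel_domain S W (linepath p q) V"
    and H: "H holomorphic_on S" and F: "F holomorphic_on W"
    and E: "E holomorphic_on B" "open B" "\<And>u. u \<in> B \<Longrightarrow> u * deriv E u = - lam * E u"
    and B: "closed_segment p q \<subseteq> B" and z: "z \<in> V"
  defines "h \<equiv> \<lambda>x. E (linepath p q x) / linepath p q x * (q - p)"
  shows "N3 (kernel_integral H F (linepath p q) h) z =
           lam * kernel_integral H F (linepath p q) h z
           + H (z $ C2) * (F (kernel_base q z) * E q - F (kernel_base p z) * E p)"
proof -
  interpret kernel_domain S W "linepath p q" V by (fact dom)
  let ?t = "linepath p q"
  have seg: "?t x \<in> closed_segment p q" if "x \<in> {0..1}" for x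
    using that linepath_in_path by blast
  have nz: "u \<noteq> 0" and kW: "kernel_base u z \<in> W" if u: "u \<in> closed_segment p q" for u
  proof -
    obtain x where "x \<in> {0..1}" "u = ?t x"
      using u unfolding linepath_image_01[symmetric] by (rule imageE)
    then show "u \<noteq> 0" "kernel_base u z \<in> W"
      using t(2) V(2)[OF z] by simp_all
  qed
  have h: "continuous_on {0..1} h"
  proof -
    have "continuous_on {0..1} (\<lambda>x. E (?t x))"
      by (rule continuous_on_compose2[OF holomorphic_on_imp_continuous_on[OF E(1)] t(1)]) (use seg B in auto)
    then show ?thesis
      unfolding h_def using t by (intro continuous_intros) auto
  qed
  have F': "deriv F holomorphic_on W"
    using F open_W by (rule holomorphic_deriv)
  define I :: "(complex \<Rightarrow> complex) \<Rightarrow> (real \<Rightarrow> complex) \<Rightarrow> complex" where "I G g = integral {0..1} (\<lambda>x. G (kernel_base (?t x) z) * g x)" for G g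
  have I: "((\<lambda>x. G (kernel_base (?t x) z) * g x) has_integral I G g) {0..1}"
    if "G holomorphic_on W" "continuous_on {0..1} g" for G g
    unfolding I_def using integrand_integrable[OF that z] by (rule integrable_integral)
  let ?\<Psi> = "\<lambda>u. F (kernel_base u z) * E u"
  \<comment> \<open>The derivative of \<open>?\<Psi>\<close>, with that of \<open>E\<close> already
    replaced by \<open>- lam * E u / u\<close>.\<close>
  let ?d = "\<lambda>u. deriv F (kernel_base u z) * (z $ Cm3 / u\<^sup>2 + z $ C3) * E u - lam * F (kernel_base u z) * E u / u"
  have "(?d has_contour_integral ?\<Psi> (pathfinish ?t) - ?\<Psi> (pathstart ?t)) ?t"
  proof (rule contour_integral_primitive)
    fix u assume u: "u \<in> closed_segment p q"
    have "((\<lambda>u. kernel_base u z) has_field_derivative z $ Cm3 / u\<^sup>2 + z $ C3) (at u)"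
      unfolding kernel_base_def using nz[OF u]
      by (auto intro!: derivative_eq_intros simp: field_simps power2_eq_square)
    with holomorphic_derivI[OF F open_W kW[OF u]]
    have "((\<lambda>u. F (kernel_base u z)) has_field_derivative
            deriv F (kernel_base u z) * (z $ Cm3 / u\<^sup>2 + z $ C3)) (at u)"
      by (rule DERIV_chain2)
    moreover have "(E has_field_derivative - lam * E u / u) (at u)"
    proof -
      have "deriv E u = - lam * E u / u"
        using E(3)[of u] u B nz[OF u] by (auto simp: field_simps)
      then show ?thesis
        using holomorphic_derivI[OF E(1,2), of u UNIV] u B by auto
    qed
    ultimately have "(?\<Psi> has_field_derivative
        deriv F (kernel_base u z) * (z $ Cm3 / u\<^sup>2 + z $ C3) * E u + (- lam * E u / u) * F (kernel_base u z)) (at u)"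
      by (rule DERIV_mult)
    then show "(?\<Psi> has_field_derivative ?d u) (at u within closed_segment p q)"
      by (auto intro!: has_field_derivative_at_within simp: mult_ac)
  qed auto
  then have "((\<lambda>x. ?d (?t x) * (q - p)) has_integral ?\<Psi> q - ?\<Psi> p) {0..1}"
    by (simp add: has_contour_integral_linepath)
  moreover have combined: "((\<lambda>x. - z $ Cm3 * (deriv F (kernel_base (?t x) z) * (h x * kernel_coeff (?t x) Cm3))
        + z $ C3 * (deriv F (kernel_base (?t x) z) * (h x * kernel_coeff (?t x) C3))
        - lam * (F (kernel_base (?t x) z) * h x))
      has_integral - z $ Cm3 * I (deriv F) (\<lambda>x. h x * kernel_coeff (?t x) Cm3)
        + z $ C3 * I (deriv F) (\<lambda>x. h x * kernel_coeff (?t x) C3) - lam * I F h) {0..1}"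
    using t by (intro has_integral_add has_integral_diff has_integral_mult_right I F F' h continuous_intros) auto
  \<comment> \<open>Pointwise on the chord, (N3 - lam) of the integrand is the exact derivative
    \<open>?d\<close> times the velocity \<open>q - p\<close>.\<close>
  have integrands: "- z $ Cm3 * (deriv F (kernel_base (?t x) z) * (h x * kernel_coeff (?t x) Cm3))
        + z $ C3 * (deriv F (kernel_base (?t x) z) * (h x * kernel_coeff (?t x) C3))
        - lam * (F (kernel_base (?t x) z) * h x) = ?d (?t x) * (q - p)" if "x \<in> {0..1}" for x
    using t(2)[OF that] by (simp add: h_def kernel_coeff_def field_simps power2_eq_square)
  note has_integral_eq[OF integrands combined]
  ultimately have "- z $ Cm3 * I (deriv F) (\<lambda>x. h x * kernel_coeff (?t x) Cm3)
        + z $ C3 * I (deriv F) (\<lambda>x. h x * kernel_coeff (?t x) C3) - lam * I F h = ?\<Psi> q - ?\<Psi> p"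
    by (rule has_integral_unique[rotated])
  then have "- z $ Cm3 * I (deriv F) (\<lambda>x. h x * kernel_coeff (?t x) Cm3)
        + z $ C3 * I (deriv F) (\<lambda>x. h x * kernel_coeff (?t x) C3) = lam * I F h + (?\<Psi> q - ?\<Psi> p)"
    by (simp only: diff_eq_eq add.commute)
  moreover have "N3 (kernel_integral H F ?t h) z = H (z $ C2) *
      (- z $ Cm3 * I (deriv F) (\<lambda>x. h x * kernel_coeff (?t x) Cm3)
        + z $ C3 * I (deriv F) (\<lambda>x. h x * kernel_coeff (?t x) C3))"
    by (simp add: N3_def partial_kernel_integral[OF H F h z])
      (simp add: kernel_integral_def I_def right_diff_distrib mult.left_commute)
  ultimately show ?thesis
    by (simp add: kernel_integral_def distrib_left mult.left_commute flip: I_def)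
qed

text \<open>A piecewise \<open>C\<^sup>1\<close> path in the sense of the library may have an unbounded, even non-integrable
  derivative near its exceptional points, so one cannot differentiate under the integral along
  the path itself; locally, the path is replaced by a chord.\<close>

lemma has_integral_path_chord:
  assumes B: "convex B" "open B" and \<Phi>: "\<Phi> holomorphic_on B"
    and \<tau>: "\<tau> piecewise_C1_differentiable_on {c..d}" and "c \<le> d" and in_B: "\<tau> ` {c..d} \<subseteq> B"
  shows "((\<lambda>s. \<Phi> (\<tau> s) * vector_derivative \<tau> (at s)) has_integral
           integral {0..1} (\<lambda>x. \<Phi> (linepath (\<tau> c) (\<tau> d) x) * (\<tau> d - \<tau> c))) {c..d}"
proof -
  \<comment> \<open>Both integrals equal the increment of this primitive, since the path and its
    chord have the same ends and lie in the convex set \<open>B\<close>.\<close>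
  obtain P where P: "\<And>u. u \<in> B \<Longrightarrow> (P has_field_derivative \<Phi> u) (at u)"
    using holomorphic_convex_primitive'[OF B \<Phi>] B(2) by (metis at_within_open)
  have "closed_segment (\<tau> c) (\<tau> d) \<subseteq> B"
    using B(1) in_B \<open>c \<le> d\<close> by (intro closed_segment_subset) auto
  then have "(\<Phi> has_contour_integral P (pathfinish (linepath (\<tau> c) (\<tau> d))) - P (pathstart (linepath (\<tau> c) (\<tau> d))))
          (linepath (\<tau> c) (\<tau> d))"
    using P by (intro contour_integral_primitive[where S = B]) (auto intro: has_field_derivative_at_within)
  then have chord: "integral {0..1} (\<lambda>x. \<Phi> (linepath (\<tau> c) (\<tau> d) x) * (\<tau> d - \<tau> c)) = P (\<tau> d) - P (\<tau> c)"
    unfolding has_contour_integral_linepath by (simp only: integral_unique pathfinish_linepath pathstart_linepath)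
  obtain X D where X: "finite X" "\<And>s. s \<in> {c..d} - X \<Longrightarrow> (\<tau> has_vector_derivative D s) (at s)"
    using \<tau> unfolding piecewise_C1_differentiable_on_def C1_differentiable_on_def by blast
  have "((\<lambda>s. \<Phi> (\<tau> s) * vector_derivative \<tau> (at s)) has_integral (P \<circ> \<tau>) d - (P \<circ> \<tau>) c) {c..d}"
  \<comment> \<open>This form for the gauge integral tolerates a finite exceptional set and yields
    integrability, however badly the velocity behaves near that set.\<close>
  proof (rule fundamental_theorem_of_calculus_strong[OF X(1) \<open>c \<le> d\<close>])
    fix s assume s: "s \<in> {c..d} - X"
    have "((P \<circ> \<tau>) has_vector_derivative D s * \<Phi> (\<tau> s)) (at s)"
      using s in_B by (intro field_vector_diff_chain_at X(2) P) auto
    then show "((P \<circ> \<tau>) has_vector_derivative \<Phi> (\<tau> s) * vector_derivative \<tau> (at s)) (at s)"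
      using vector_derivative_at[OF X(2)[OF s]] by (simp add: mult.commute)
  next
    have "continuous_on B P"
      using P by (auto intro!: continuous_at_imp_continuous_on DERIV_isCont)
    then show "continuous_on {c..d} (P \<circ> \<tau>)"
      using \<tau> in_B unfolding piecewise_C1_differentiable_on_def
      by (intro continuous_on_compose) (auto intro: continuous_on_subset)
  qed
  then show ?thesis
    by (simp only: chord o_def)
qed

section \<open>Locality and additivity of the differential operators\<close>

lemma laplacian_cong:
  assumes "open U" "z \<in> U" "\<And>y. y \<in> U \<Longrightarrow> f y = g y"
  shows "laplacian f z = laplacian g z"
proof -
  have "partial i (partial j f) z = partial i (partial j g) z" for i j
    using assms by (intro partial_cong[OF assms(1,2)] partial_cong[OF assms(1)])
  then show ?thesis
    by (simp add: laplacian_def)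
qed

lemma laplacian_add:
  assumes U: "open U" "z \<in> U" and f: "sev_holomorphic_on f U" and g: "sev_holomorphic_on g U"
  shows "laplacian (\<lambda>z. f z + g z) z = laplacian f z + laplacian g z"
proof -
  have "partial i (partial j (\<lambda>z. f z + g z)) z = partial i (partial j f) z + partial i (partial j g) z" for i j
  proof -
    have "partial i (partial j (\<lambda>z. f z + g z)) z = partial i (\<lambda>z. partial j f z + partial j g z) z"
      by (intro partial_cong[OF U] partial_add[OF f g])
    also have "\<dots> = partial i (partial j f) z + partial i (partial j g) z"
      using f g U by (intro partial_add[where U = U] sev_holomorphic_on_partial)
    finally show ?thesis .
  qed
  then show ?thesis
    by (simp add: laplacian_def algebra_simps)
qed

lemma N2_cong:
  assumes "open U" "z \<in> U" "\<And>y. y \<in> U \<Longrightarrow> f y = g y"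
  shows "N2 f z = N2 g z"
  using partial_cong[OF assms] by (simp add: N2_def)

lemma N3_cong:
  assumes "open U" "z \<in> U" "\<And>y. y \<in> U \<Longrightarrow> f y = g y"
  shows "N3 f z = N3 g z"
  using partial_cong[OF assms] by (simp add: N3_def)

section \<open>The equations over compact parts of the contour\<close>

text \<open>The setting for compact parts of the contour. Integrability over the whole open interval
  serves to split the integral where two pieces meet.\<close>

locale contour_kernel =
  fixes \<alpha> \<nu> lam :: complex and \<Omega> :: "(complex ^ coord) set" and \<tau> l :: "real \<Rightarrow> complex"
    and pz :: "complex ^ coord \<Rightarrow> complex" and pu :: "real \<times> (complex ^ coord) \<Rightarrow> complex"
  assumes open_\<Omega>: "open \<Omega>"
    and contour: "\<And>a b. 0 < a \<Longrightarrow> a < b \<Longrightarrow> b < 1 \<Longrightarrow> \<tau> piecewise_C1_differentiable_on {a..b}"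
    and log_tau: "continuous_on {0<..<1} l" "\<And>s. s \<in> {0<..<1} \<Longrightarrow> exp (l s) = \<tau> s"
    and branch_z2: "power_branch \<Omega> (\<lambda>z. z $ C2) \<alpha> pz"
    and branch_base: "power_branch ({0<..<1} \<times> \<Omega>) (\<lambda>(s, z). kernel_base (\<tau> s) z) \<nu> pu"
    and integrable: "\<And>z. z \<in> \<Omega> \<Longrightarrow> K_integrand lam \<tau> l pz pu z integrable_on {0<..<1}"
begin

definition K_part :: "real \<Rightarrow> real \<Rightarrow> complex ^ coord \<Rightarrow> complex" where
  "K_part c d z = integral {c..d} (K_integrand lam \<tau> l pz pu z)"

definition boundary_term :: "complex ^ coord \<Rightarrow> real \<Rightarrow> complex" where
  "boundary_term z s = pu (s, z) * exp (- lam * l s)"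

text \<open>The equation for N3 carries its boundary difference explicitly, so that it telescopes
  when intervals are joined.\<close>

definition K_equations :: "real \<Rightarrow> real \<Rightarrow> (complex ^ coord) set \<Rightarrow> bool" where
  "K_equations c d V \<longleftrightarrow> sev_holomorphic_on (K_part c d) V \<and>
     (\<forall>z\<in>V. laplacian (K_part c d) z = 0 \<and> N2 (K_part c d) z = \<alpha> * K_part c d z \<and>
        N3 (K_part c d) z = lam * K_part c d z + pz z * (boundary_term z d - boundary_term z c))"

lemma continuous_tau: "continuous_on {0<..<1} \<tau>"
  using continuous_on_exp[OF log_tau(1)] log_tau(2) continuous_on_cong by (metis (no_types, lifting))

lemma tau_nonzero: "s \<in> {0<..<1} \<Longrightarrow> \<tau> s \<noteq> 0"
  using log_tau(2)[of s] exp_not_eq_zero[of "l s"] by simp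

text \<open>Near \<open>s0\<close> and \<open>z0\<close> the three branches become holomorphic
  functions of their bases, and a short piece of the contour may be traded for its chord, to which
  the computations for \<open>kernel_integral\<close> apply. One \<open>V\<close> serves all short
  intervals around \<open>s0\<close>, as subdivision of a compact interval requires.\<close>

lemma K_equations_local:
  assumes s0: "s0 \<in> {0<..<1}" and z0: "z0 \<in> \<Omega>"
  shows "\<exists>\<delta>>0. \<exists>V. open V \<and> z0 \<in> V \<and> V \<subseteq> \<Omega> \<and>
    (\<forall>c d. c \<le> s0 \<and> s0 \<le> d \<and> d - c < \<delta> \<longrightarrow> 0 < c \<and> d < 1 \<and> K_equations c d V)"
proof -
  define w0 where "w0 = kernel_base (\<tau> s0) z0"
  have "continuous_on ({0<..<1} \<times> \<Omega>) (\<lambda>x. kernel_base (\<tau> (fst x)) (snd x))"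
    using tau_nonzero
    by (intro continuous_intros continuous_on_compose2[OF continuous_tau]) auto
  moreover have "(s0, z0) \<in> {0<..<1} \<times> \<Omega>"
    using s0 z0 by simp
  ultimately obtain eF UF F where F: "0 < eF" "open UF" "(s0, z0) \<in> UF" "F holomorphic_on ball w0 eF"
    and F_eq: "\<And>x. x \<in> ({0<..<1} \<times> \<Omega>) \<inter> UF \<Longrightarrow> pu x = F (kernel_base (\<tau> (fst x)) (snd x))"
    by (rule power_branch_local[OF branch_base, of "(s0, z0)", unfolded split_beta fst_conv snd_conv,
          folded w0_def]) blast
  have "continuous_on \<Omega> (\<lambda>z. z $ C2)"
    by (intro continuous_intros)
  from power_branch_local[OF branch_z2 this z0]
  obtain eH H UH where H: "open UH" "z0 \<in> UH" "H holomorphic_on ball (z0 $ C2) eH"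
    "\<And>u. u \<in> ball (z0 $ C2) eH \<Longrightarrow> u * deriv H u = \<alpha> * H u"
    "\<And>z. z \<in> \<Omega> \<inter> UH \<Longrightarrow> z $ C2 \<in> ball (z0 $ C2) eH \<and> pz z = H (z $ C2)"
    by metis
  have "power_branch {0<..<1} \<tau> (- lam) (\<lambda>s. exp (- lam * l s))"
    using log_tau unfolding power_branch_def by blast
  from power_branch_local[OF this continuous_tau s0]
  obtain eE E UE where E: "0 < eE" "open UE" "s0 \<in> UE" "E holomorphic_on ball (\<tau> s0) eE"
    "\<And>u. u \<in> ball (\<tau> s0) eE \<Longrightarrow> u * deriv E u = - lam * E u"
    "\<And>s. s \<in> {0<..<1} \<inter> UE \<Longrightarrow> exp (- lam * l s) = E (\<tau> s)"
    by metis
  \<comment> \<open>The linear form must be controlled for all u near \<open>\<tau> s0\<close>, not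
    only for u on the contour, because the chord leaves the contour.\<close>
  have "open ({p \<in> (- {0}) \<times> UNIV. kernel_base (fst p) (snd p) \<in> ball w0 eF})" (is "open ?N")
  proof -
    have "continuous_on ((- {0}) \<times> UNIV) (\<lambda>p. kernel_base (fst p) (snd p))"
      by (intro continuous_intros) auto
    then have "open (((- {0}) \<times> UNIV) \<inter> (\<lambda>p. kernel_base (fst p) (snd p)) -` ball w0 eF)"
      by (intro continuous_open_preimage open_Times) auto
    then show ?thesis by (simp add: Int_def vimage_def)
  qed
  moreover have "(\<tau> s0, z0) \<in> ?N"
    using tau_nonzero[OF s0] F(1) by (simp add: w0_def)
  ultimately obtain T V1 where T: "open T" "open V1" "\<tau> s0 \<in> T" "z0 \<in> V1" "T \<times> V1 \<subseteq> ?N"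
    by (rule open_prod_elim) auto
  obtain U1 V2 where U1: "open U1" "open V2" "s0 \<in> U1" "z0 \<in> V2" "U1 \<times> V2 \<subseteq> UF"
    using open_prod_elim[OF F(2,3)] by (metis mem_Sigma_iff)
  define V where "V = V1 \<inter> V2 \<inter> UH \<inter> \<Omega>"
  have "open (T \<inter> ball (\<tau> s0) eE)" "\<tau> s0 \<in> T \<inter> ball (\<tau> s0) eE"
    using T(1,3) E(1) by auto
  then obtain \<rho> where \<rho>: "0 < \<rho>" "ball (\<tau> s0) \<rho> \<subseteq> T \<inter> ball (\<tau> s0) eE"
    by (rule openE)
  have "open ({0<..<1} \<inter> \<tau> -` ball (\<tau> s0) \<rho>)"
    using continuous_tau by (intro continuous_open_preimage) auto
  then have "open (({0<..<1} \<inter> \<tau> -` ball (\<tau> s0) \<rho>) \<inter> U1 \<inter> UE)"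
    using U1(1) E(2) by (rule open_Int[OF open_Int])
  then obtain \<delta> where \<delta>: "0 < \<delta>" "ball s0 \<delta> \<subseteq> ({0<..<1} \<inter> \<tau> -` ball (\<tau> s0) \<rho>) \<inter> U1 \<inter> UE"
    using s0 U1(3) E(3) \<rho>(1) by (meson IntI centre_in_ball openE vimageI)
  have V: "open V" "z0 \<in> V" "V \<subseteq> \<Omega>"
    using T U1 H open_\<Omega> z0 by (auto simp: V_def)
  have "0 < c \<and> d < 1 \<and> K_equations c d V" if cd: "c \<le> s0" "s0 \<le> d" "d - c < \<delta>" for c d
  proof -
    let ?B = "ball (\<tau> s0) \<rho>" and ?t = "linepath (\<tau> c) (\<tau> d)"
    have sub: "s \<in> ball s0 \<delta>" if "s \<in> {c..d}" for s
      using that cd by (auto simp: dist_real_def)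
    have s: "s \<in> {0<..<1}" "\<tau> s \<in> ?B" "s \<in> U1" "s \<in> UE" if "s \<in> {c..d}" for s
      using sub[OF that] \<delta>(2) by auto
    have ends: "c \<in> {c..d}" "d \<in> {c..d}"
      using cd by auto
    have "0 < c" "d < 1"
      using s(1)[OF ends(1)] s(1)[OF ends(2)] by auto
    have BN: "u \<noteq> 0" "kernel_base u z \<in> ball w0 eF" if "u \<in> ?B" "z \<in> V" for u z
    proof -
      have "(u, z) \<in> ?N"
        using that \<rho>(2) T(5) unfolding V_def by blast
      then show "u \<noteq> 0" "kernel_base u z \<in> ball w0 eF" by auto
    qed
    have seg: "closed_segment (\<tau> c) (\<tau> d) \<subseteq> ?B"
      using s(2)[OF ends(1)] s(2)[OF ends(2)] by (intro closed_segment_subset) auto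
    have t_B: "?t x \<in> ?B" if "x \<in> {0..1}" for x
      using linepath_in_path[OF that] seg by blast
    interpret dom: kernel_domain "ball (z0 $ C2) eH" "ball w0 eF" ?t V
    proof
      show "?t x \<noteq> 0" if "x \<in> {0..1}" for x
        using BN(1)[OF t_B[OF that] V(2)] .
      show "z $ C2 \<in> ball (z0 $ C2) eH" if "z \<in> V" for z
        using H(5)[of z] that by (simp add: V_def)
      show "kernel_base (?t x) z \<in> ball w0 eF" if "z \<in> V" "x \<in> {0..1}" for z x
        using BN(2)[OF t_B[OF that(2)] that(1)] .
    qed (use V(1) in \<open>auto intro: continuous_on_linepath\<close>)
    define h where "h x = E (?t x) / ?t x * (\<tau> d - \<tau> c)" for x
    have EB: "E holomorphic_on ?B"
      using E(4) \<rho>(2) by (meson holomorphic_on_subset le_inf_iff)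
    have h: "continuous_on {0..1} h"
    proof -
      have "continuous_on {0..1} (\<lambda>x. E (?t x))"
        by (rule continuous_on_compose2[OF holomorphic_on_imp_continuous_on[OF EB] dom.t(1)]) (use t_B in auto)
      then show ?thesis
        unfolding h_def using dom.t by (intro continuous_intros) auto
    qed
    let ?G = "kernel_integral H F ?t h"
    \<comment> \<open>The hypothesis on the contour concerns nondegenerate intervals, while
      \<open>c = d\<close> may occur here; hence the detour through a larger interval inside the
      open unit interval.\<close>
    have \<tau>_cd: "\<tau> piecewise_C1_differentiable_on {c..d}"
    proof (rule piecewise_C1_differentiable_on_subset)
      show "\<tau> piecewise_C1_differentiable_on {c / 2..(d + 1) / 2}"
        using \<open>0 < c\<close> \<open>d < 1\<close> cd by (intro contour) auto
    qed (use \<open>0 < c\<close> \<open>d < 1\<close> in auto)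
    have K_eq: "K_part c d z = ?G z" if z: "z \<in> V" for z
    proof -
      \<comment> \<open>For fixed z the integrand is a holomorphic function of \<tau> times d\<tau>;
        the factor \<open>E u / u\<close> is the local form of the power with exponent -lam -
        1.\<close>
      let ?\<Phi> = "\<lambda>u. F (kernel_base u z) * (E u / u)"
      have kb: "(\<lambda>u. kernel_base u z) holomorphic_on ?B"
        unfolding kernel_base_def using BN(1)[OF _ z] by (intro holomorphic_intros) auto
      have "(F \<circ> (\<lambda>u. kernel_base u z)) holomorphic_on ?B"
        using BN(2)[OF _ z] by (intro holomorphic_on_compose_gen[OF kb F(4)]) auto
      then have "?\<Phi> holomorphic_on ?B"
        using BN(1)[OF _ z] by (intro holomorphic_intros EB) (auto simp: o_def)
      then have "((\<lambda>s. ?\<Phi> (\<tau> s) * vector_derivative \<tau> (at s)) has_integral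
          integral {0..1} (\<lambda>x. ?\<Phi> (?t x) * (\<tau> d - \<tau> c))) {c..d}"
        using s(2) cd by (intro has_integral_path_chord[where B = ?B] \<tau>_cd) auto
      then have "((\<lambda>s. H (z $ C2) * (?\<Phi> (\<tau> s) * vector_derivative \<tau> (at s))) has_integral
          H (z $ C2) * integral {0..1} (\<lambda>x. ?\<Phi> (?t x) * (\<tau> d - \<tau> c))) {c..d}"
        by (rule has_integral_mult_right)
      then have "((\<lambda>s. H (z $ C2) * (?\<Phi> (\<tau> s) * vector_derivative \<tau> (at s))) has_integral ?G z) {c..d}"
        by (simp only: kernel_integral_def h_def mult.assoc)
      moreover have integrand: "H (z $ C2) * (?\<Phi> (\<tau> r) * vector_derivative \<tau> (at r)) = K_integrand lam \<tau> l pz pu z r"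
        if r: "r \<in> {c..d}" for r
      proof -
        have "exp ((- lam - 1) * l r) = exp (- lam * l r) / exp (l r)"
          by (simp add: left_diff_distrib exp_diff)
        also have "\<dots> = E (\<tau> r) / \<tau> r"
          using E(6)[of r] log_tau(2)[OF s(1)[OF r]] s(1,4)[OF r] by simp
        finally have "exp ((- lam - 1) * l r) = E (\<tau> r) / \<tau> r" .
        moreover have "pu (r, z) = F (kernel_base (\<tau> r) z)"
          using s(1,3)[OF r] z U1(5) F_eq[of "(r, z)"] by (auto simp: V_def)
        moreover have "pz z = H (z $ C2)"
          using H(5)[of z] z by (simp add: V_def)
        ultimately show ?thesis
          by (simp add: K_integrand_def)
      qed
      ultimately show ?thesis
        unfolding K_part_def by (intro integral_unique) (rule has_integral_eq)
    qed
    have "sev_holomorphic_on (K_part c d) V"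
      by (rule sev_holomorphic_on_cong[OF dom.sev_holomorphic_on_kernel_integral[OF H(3) F(4) h] V(1)])
        (simp add: K_eq)
    moreover have "laplacian (K_part c d) z = 0" if "z \<in> V" for z
      using laplacian_cong[OF V(1) that K_eq] dom.laplacian_kernel_integral[OF H(3) F(4) h that] by simp
    moreover have "N2 (K_part c d) z = \<alpha> * K_part c d z" if "z \<in> V" for z
      using N2_cong[OF V(1) that K_eq] dom.N2_kernel_integral[OF H(3,4) F(4) h that] K_eq[OF that] by simp
    moreover have "N3 (K_part c d) z = lam * K_part c d z + pz z * (boundary_term z d - boundary_term z c)"
      if z: "z \<in> V" for z
    proof -
      have "N3 ?G z = lam * ?G z + H (z $ C2) *
          (F (kernel_base (\<tau> d) z) * E (\<tau> d) - F (kernel_base (\<tau> c) z) * E (\<tau> c))"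
        unfolding h_def using E(5) \<rho>(2)
        by (intro N3_kernel_integral_linepath[OF dom.kernel_domain_axioms H(3) F(4) EB _ _ seg z]) auto
      moreover have "boundary_term z r = F (kernel_base (\<tau> r) z) * E (\<tau> r)" if r: "r \<in> {c..d}" for r
      proof -
        have "pu (r, z) = F (kernel_base (\<tau> r) z)"
          using s(1,3)[OF r] z U1(5) F_eq[of "(r, z)"] by (auto simp: V_def)
        then show ?thesis
          using E(6)[of r] s(1,4)[OF r] by (simp add: boundary_term_def)
      qed
      moreover have "pz z = H (z $ C2)"
        using H(5)[of z] z by (simp add: V_def)
      ultimately show ?thesis
        using N3_cong[OF V(1) z K_eq] K_eq[OF z] ends by simp
    qed
    ultimately show ?thesis
      using \<open>0 < c\<close> \<open>d < 1\<close> unfolding K_equations_def by blast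
  qed
  with \<delta>(1) V show ?thesis by blast
qed

text \<open>The integral is additive in the interval and the operators are linear; the boundary
  terms at \<open>d\<close> cancel.\<close>

lemma K_equations_join:
  assumes cde: "0 < c" "c \<le> d" "d \<le> e" "e < 1"
    and V: "open V" "V \<subseteq> \<Omega>" and cd: "K_equations c d V" and de: "K_equations d e V"
  shows "K_equations c e V"
proof -
  have K_eq: "K_part c e z = K_part c d z + K_part d e z" if "z \<in> V" for z
  proof -
    have "K_integrand lam \<tau> l pz pu z integrable_on cbox c e"
      using integrable[of z] that V(2) cde by (intro integrable_on_subcbox[of _ "{0<..<1}"]) auto
    then show ?thesis
      unfolding K_part_def using cde by (intro Henstock_Kurzweil_Integration.integral_combine[symmetric]) auto
  qed
  have hol: "sev_holomorphic_on (K_part c d) V" "sev_holomorphic_on (K_part d e) V"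
    using cd de by (auto simp: K_equations_def)
  have "sev_holomorphic_on (K_part c e) V"
    by (rule sev_holomorphic_on_cong[OF sev_holomorphic_on_add[OF hol] V(1)]) (simp add: K_eq)
  moreover have "laplacian (K_part c e) z = 0" if "z \<in> V" for z
    using laplacian_cong[OF V(1) that K_eq] laplacian_add[OF V(1) that hol] cd de that
    by (simp add: K_equations_def)
  moreover
  have part: "partial j (K_part c e) z = partial j (K_part c d) z + partial j (K_part d e) z"
    if "z \<in> V" for j z
    using partial_cong[OF V(1) that K_eq] partial_add[OF hol that] by simp
  then have N_add: "N2 (K_part c e) z = N2 (K_part c d) z + N2 (K_part d e) z"
    "N3 (K_part c e) z = N3 (K_part c d) z + N3 (K_part d e) z" if "z \<in> V" for z
    using that by (simp_all add: N2_def N3_def algebra_simps)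
  moreover have "N2 (K_part c e) z = \<alpha> * K_part c e z"
    "N3 (K_part c e) z = lam * K_part c e z + pz z * (boundary_term z e - boundary_term z c)"
    if z: "z \<in> V" for z
  proof -
    have "N2 (K_part c d) z = \<alpha> * K_part c d z" "N2 (K_part d e) z = \<alpha> * K_part d e z"
      "N3 (K_part c d) z = lam * K_part c d z + pz z * (boundary_term z d - boundary_term z c)"
      "N3 (K_part d e) z = lam * K_part d e z + pz z * (boundary_term z e - boundary_term z d)"
      using cd de z by (auto simp: K_equations_def)
    then show "N2 (K_part c e) z = \<alpha> * K_part c e z"
      "N3 (K_part c e) z = lam * K_part c e z + pz z * (boundary_term z e - boundary_term z c)"
      unfolding N_add[OF z] K_eq[OF z] by (simp_all only:) (simp_all add: algebra_simps)
  qed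
  ultimately show ?thesis
    by (auto simp: K_equations_def)
qed

lemma K_equations_subset: "K_equations c d V \<Longrightarrow> V' \<subseteq> V \<Longrightarrow> K_equations c d V'"
  unfolding K_equations_def by (auto intro: sev_holomorphic_on_subset)

text \<open>For fixed z, bisection of the interval reduces the claim to short pieces. The
  neighbourhood of z may shrink at each join, which is harmless because all the equations are local
  in z.\<close>

lemma K_equations_compact:
  assumes "0 < a" "a \<le> b" "b < 1"
  shows "K_equations a b \<Omega>"
proof -
  have loc: "\<exists>V. open V \<and> z \<in> V \<and> V \<subseteq> \<Omega> \<and> K_equations a b V" if z: "z \<in> \<Omega>" for z
  proof -
    \<comment> \<open>The bounds on the ends belong to the induction predicate, since the joining
      step needs them for every intermediate interval.\<close>
    have "0 < a \<and> b < 1 \<and> (\<exists>V. open V \<and> z \<in> V \<and> V \<subseteq> \<Omega> \<and> K_equations a b V)"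
      using \<open>a \<le> b\<close>
    proof (induction rule: Bolzano)
      case (trans c d e)
      then obtain V V' where "open V" "z \<in> V" "V \<subseteq> \<Omega>" "K_equations c d V"
        "open V'" "z \<in> V'" "K_equations d e V'" by blast
      moreover from this trans have "K_equations c e (V \<inter> V')"
        by (intro K_equations_join[of c d e]) (auto intro: K_equations_subset)
      ultimately show ?case
        using trans by (intro conjI exI[of _ "V \<inter> V'"]) auto
    next
      case (local s)
      then have "s \<in> {0<..<1}"
        using assms by auto
      from K_equations_local[OF this z] show ?case by blast
    qed
    then show ?thesis by blast
  qed
  then show ?thesis
    unfolding K_equations_def by (intro conjI ballI sev_holomorphic_onI_local) meson+
qed

end

section \<open>Passage to the whole contour\<close>

lemma partial_tendsto:
  assumes "open U" "\<forall>\<^sub>F n in F. sev_holomorphic_on (f n) U" "uniform_limit U f g F" "F \<noteq> bot" "z \<in> U"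
  shows "((\<lambda>n. partial j (f n) z) \<longlongrightarrow> partial j g z) F"
  using partial_uniform_limit[OF assms, of j] by (auto intro: tendsto_uniform_limitI)

text \<open>First partial derivatives converge uniformly on a smaller neighbourhood and are
  holomorphic there, so the convergence result can be applied to them a second time.\<close>

lemma laplacian_tendsto:
  assumes "open U" and f: "\<forall>\<^sub>F n in F. sev_holomorphic_on (f n) U"
    and "uniform_limit U f g F" "F \<noteq> bot" "z \<in> U"
  shows "((\<lambda>n. laplacian (f n) z) \<longlongrightarrow> laplacian g z) F"
proof -
  have "((\<lambda>n. partial i (partial j (f n)) z) \<longlongrightarrow> partial i (partial j g) z) F" for i j
  proof -
    obtain V where V: "open V" "z \<in> V" "V \<subseteq> U" "uniform_limit V (\<lambda>n. partial j (f n)) (partial j g) F"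
      using partial_uniform_limit[OF assms, of j] by blast
    have "\<forall>\<^sub>F n in F. sev_holomorphic_on (partial j (f n)) V"
      using f
    proof eventually_elim
      case (elim n)
      then show ?case
        using V(1,3) by (intro sev_holomorphic_on_partial) (rule sev_holomorphic_on_subset)
    qed
    then show ?thesis
      by (rule partial_tendsto[OF V(1) _ V(4) \<open>F \<noteq> bot\<close> V(2)])
  qed
  then show ?thesis
    unfolding laplacian_def by (intro tendsto_intros)
qed

theorem proposition6p2:
  fixes \<alpha> \<nu> lam :: complex
    and \<Omega> :: "(complex ^ coord) set"
    and \<tau> l :: "real \<Rightarrow> complex"
    and pz :: "complex ^ coord \<Rightarrow> complex"
    and pu :: "real \<times> (complex ^ coord) \<Rightarrow> complex"
  assumes "open \<Omega>"
    and contour: "\<And>a b. 0 < a \<Longrightarrow> a < b \<Longrightarrow> b < 1 \<Longrightarrow> \<tau> piecewise_C1_differentiable_on {a..b}"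
    and log_tau: "continuous_on {0<..<1} l" "\<And>s. s \<in> {0<..<1} \<Longrightarrow> exp (l s) = \<tau> s"
    and branch_z2: "power_branch \<Omega> (\<lambda>z. z $ C2) \<alpha> pz"
    and branch_base: "power_branch ({0<..<1} \<times> \<Omega>) (\<lambda>(s, z). kernel_base (\<tau> s) z) \<nu> pu"
    and convergence: "K_locally_uniformly_convergent \<Omega> lam \<tau> l pz pu"
    and ends: "\<And>z. z \<in> \<Omega> \<Longrightarrow> end_difference_zero (\<lambda>s. pu (s, z) * exp (- lam * l s))"
  shows "harmonic_on (K lam \<tau> l pz pu) \<Omega> \<and>
    (\<forall>z\<in>\<Omega>. N2 (K lam \<tau> l pz pu) z = \<alpha> * K lam \<tau> l pz pu z) \<and>
    (\<forall>z\<in>\<Omega>. N3 (K lam \<tau> l pz pu) z = lam * K lam \<tau> l pz pu z)"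
proof -
  interpret contour_kernel \<alpha> \<nu> lam \<Omega> \<tau> l pz pu
  proof
    show "K_integrand lam \<tau> l pz pu z integrable_on {0<..<1}" if "z \<in> \<Omega>" for z
      using convergence that by (simp add: K_locally_uniformly_convergent_def)
  qed (fact assms)+
  define F where "F = at_right (0 :: real) \<times>\<^sub>F at_left (1 :: real)"
  define f where "f p = K_part (fst p) (snd p)" for p
  let ?K = "K lam \<tau> l pz pu"
  have F: "F \<noteq> bot"
    by (simp add: F_def prod_filter_eq_bot)
  \<comment> \<open>The value 1/2 merely separates the two ends, so that eventually they bound a
    compact interval inside the open unit interval.\<close>
  have "\<forall>\<^sub>F p in F. fst p \<in> {0<..<1/2} \<and> snd p \<in> {1/2<..<1}"
    unfolding F_def eventually_prod_filter
    by (intro exI[of _ "\<lambda>a. a \<in> {0<..<1/2}"] exI[of _ "\<lambda>b. b \<in> {1/2<..<1}"] conjI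
        eventually_at_right_real eventually_at_left_real) auto
  then have equations: "\<forall>\<^sub>F p in F. K_equations (fst p) (snd p) \<Omega>"
    by eventually_elim (intro K_equations_compact; simp)
  \<comment> \<open>Each boundary value depends on one end only, so its limit is taken along a
    projection of the product filter.\<close>
  have at_0: "filterlim fst (at_right 0) F" and at_1: "filterlim snd (at_left 1) F"
    unfolding F_def by (simp_all add: filterlim_def filtermap_fst_prod_filter filtermap_snd_prod_filter)
  have local: "\<exists>U. open U \<and> z \<in> U \<and> U \<subseteq> \<Omega> \<and> uniform_limit U f ?K F \<and>
      (\<forall>\<^sub>F p in F. sev_holomorphic_on (f p) U)" if z: "z \<in> \<Omega>" for z
  proof -
    obtain U where U: "open U" "z \<in> U" "U \<subseteq> \<Omega>"
      "uniform_limit U (\<lambda>(a, b) y. integral {a..b} (K_integrand lam \<tau> l pz pu y)) ?K F"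
      using bspec[OF conjunct2[OF convergence[unfolded K_locally_uniformly_convergent_def]] z, folded F_def]
      by (elim exE conjE) (rule that)
    moreover have "f = (\<lambda>(a, b) y. integral {a..b} (K_integrand lam \<tau> l pz pu y))"
      by (simp add: fun_eq_iff f_def K_part_def split_beta)
    moreover have "\<forall>\<^sub>F p in F. sev_holomorphic_on (f p) U"
      using equations
    proof eventually_elim
      case (elim p)
      then have "sev_holomorphic_on (f p) \<Omega>"
        by (simp add: f_def K_equations_def)
      then show ?case
        using U(3) by (rule sev_holomorphic_on_subset)
    qed
    ultimately show ?thesis by metis
  qed
  have "sev_holomorphic_on ?K \<Omega>"
  proof (rule sev_holomorphic_onI_local)
    fix z assume "z \<in> \<Omega>"
    with local show "\<exists>V. open V \<and> z \<in> V \<and> sev_holomorphic_on ?K V"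
      using sev_holomorphic_on_uniform_limit[OF _ _ _ F] by meson
  qed
  moreover have "laplacian ?K z = 0 \<and> N2 ?K z = \<alpha> * ?K z \<and> N3 ?K z = lam * ?K z" if z: "z \<in> \<Omega>" for z
  proof -
    obtain U where U: "open U" "z \<in> U" "uniform_limit U f ?K F"
      "\<forall>\<^sub>F p in F. sev_holomorphic_on (f p) U"
      using local[OF z] by blast
    have f_lim: "((\<lambda>p. f p z) \<longlongrightarrow> ?K z) F"
      using U(3,2) by (rule tendsto_uniform_limitI)
    have N2_lim: "((\<lambda>p. N2 (f p) z) \<longlongrightarrow> N2 ?K z) F"
      and N3_lim: "((\<lambda>p. N3 (f p) z) \<longlongrightarrow> N3 ?K z) F"
      unfolding N2_def N3_def
      by (intro tendsto_intros partial_tendsto[OF U(1,4,3) F U(2)])+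
    obtain g0 g1 where g: "(boundary_term z \<longlongrightarrow> g0) (at_right 0)" "(boundary_term z \<longlongrightarrow> g1) (at_left 1)"
      "g1 - g0 = 0"
      using ends[OF z] unfolding end_difference_zero_def boundary_term_def by blast
    have "((\<lambda>p. lam * f p z + pz z * (boundary_term z (snd p) - boundary_term z (fst p)))
            \<longlongrightarrow> lam * ?K z + pz z * (g1 - g0)) F"
      by (intro tendsto_intros f_lim filterlim_compose[OF g(1) at_0] filterlim_compose[OF g(2) at_1])
    moreover have "\<forall>\<^sub>F p in F. lam * f p z + pz z * (boundary_term z (snd p) - boundary_term z (fst p)) = N3 (f p) z"
      using equations by eventually_elim (use z in \<open>simp add: K_equations_def f_def\<close>)
    ultimately have "((\<lambda>p. N3 (f p) z) \<longlongrightarrow> lam * ?K z) F"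
      using g(3) by (auto dest: Lim_transform_eventually)
    then have "N3 ?K z = lam * ?K z"
      using tendsto_unique[OF F N3_lim] by simp
    moreover have "\<forall>\<^sub>F p in F. \<alpha> * f p z = N2 (f p) z"
      using equations by eventually_elim (use z in \<open>simp add: K_equations_def f_def\<close>)
    with tendsto_mult[OF tendsto_const f_lim, of \<alpha>] have "((\<lambda>p. N2 (f p) z) \<longlongrightarrow> \<alpha> * ?K z) F"
      by (rule Lim_transform_eventually)
    then have "N2 ?K z = \<alpha> * ?K z"
      using tendsto_unique[OF F N2_lim] by simp
    moreover have "\<forall>\<^sub>F p in F. laplacian (f p) z = 0"
      using equations by eventually_elim (use z in \<open>simp add: K_equations_def f_def\<close>)
    with laplacian_tendsto[OF U(1,4,3) F U(2)] have "((\<lambda>p. 0) \<longlongrightarrow> laplacian ?K z) F"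
      by (rule Lim_transform_eventually)
    then have "laplacian ?K z = 0"
      using F by (simp add: tendsto_const_iff)
    ultimately show ?thesis by blast
  qed
  ultimately show ?thesis
    by (simp add: harmonic_on_def)
qed

end
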